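(* For every constant $0<\alpha\le 1$ there exists an integer $d_0\ge1$ such that the following holds for all $d\ge d_0$. Let $G$ be a bipartite graph with maximum degree $d$ and minimum degree at least $\alpha d$, and let $f(v)=\deg(v)-\left\lfloor \frac{\alpha}{1000}\sqrt{d\log d}\right\rfloor$ for each $v\in V(G)$. Then $G$ is $f$-removable.
   Context: All graphs are finite and simple; $\log$ is the natural logarithm. For a graph $G$, a function $f:V(G)\to\mathbb Z$, a vertex $u$ and $W\subseteq N(u)$, $\mathsf{DelSave}(G,f,u,W)$ outputs $G'=G-u$ and $f'$ with $f'(x)=f(x)-1$ for $x\in N(u)\setminus W$ and $f'(x)=f(x)$ otherwise; it is legal if $f(u)>\sum_{w\in W}f(w)$ and $f'(x)\ge1$ for all $x\in V(G')$. $G$ is $f$-removable if all vertices of $G$ can be deleted by successive legal $\mathsf{DelSave}$ applications, each time replacing $(G,f)$ by the output $(G',f')$. *)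

theory Defs
  imports Complex_Main
begin

definition simple_graph :: "'a set \<Rightarrow> ('a \<Rightarrow> 'a \<Rightarrow> bool) \<Rightarrow> bool" where
  "simple_graph V E \<longleftrightarrow> finite V \<and> (\<forall>x y. E x y \<longrightarrow> x \<in> V \<and> y \<in> V)
     \<and> (\<forall>x y. E x y \<longrightarrow> E y x) \<and> (\<forall>x. \<not> E x x)"

definition nbr :: "'a set \<Rightarrow> ('a \<Rightarrow> 'a \<Rightarrow> bool) \<Rightarrow> 'a \<Rightarrow> 'a set" where
  "nbr V E u = {x \<in> V. E u x}"

definition deg :: "'a set \<Rightarrow> ('a \<Rightarrow> 'a \<Rightarrow> bool) \<Rightarrow> 'a \<Rightarrow> nat" where
  "deg V E u = card (nbr V E u)"

definition bipartite :: "'a set \<Rightarrow> ('a \<Rightarrow> 'a \<Rightarrow> bool) \<Rightarrow> bool" where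
  "bipartite V E \<longleftrightarrow> (\<exists>A B. A \<union> B = V \<and> A \<inter> B = {} \<and>
      (\<forall>x\<in>V. \<forall>y\<in>V. E x y \<longrightarrow> (x \<in> A \<and> y \<in> B) \<or> (x \<in> B \<and> y \<in> A)))"

definition max_degree :: "'a set \<Rightarrow> ('a \<Rightarrow> 'a \<Rightarrow> bool) \<Rightarrow> nat \<Rightarrow> bool" where
  "max_degree V E d \<longleftrightarrow> V \<noteq> {} \<and> Max (deg V E ` V) = d"

definition delsave_f :: "'a set \<Rightarrow> ('a \<Rightarrow> 'a \<Rightarrow> bool) \<Rightarrow> ('a \<Rightarrow> int) \<Rightarrow> 'a \<Rightarrow> 'a set \<Rightarrow> ('a \<Rightarrow> int)" where
  "delsave_f V E f u W = (\<lambda>x. if x \<in> nbr V E u - W then f x - 1 else f x)"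

definition delsave_legal :: "'a set \<Rightarrow> ('a \<Rightarrow> 'a \<Rightarrow> bool) \<Rightarrow> ('a \<Rightarrow> int) \<Rightarrow> 'a \<Rightarrow> 'a set \<Rightarrow> bool" where
  "delsave_legal V E f u W \<longleftrightarrow> u \<in> V \<and> W \<subseteq> nbr V E u \<and> f u > sum f W
     \<and> (\<forall>x \<in> V - {u}. delsave_f V E f u W x \<ge> 1)"

text \<open>f-removable: all vertices can be deleted by successive legal DelSave steps.
  The edge relation E is kept; the current graph is the subgraph induced on the current vertex set.\<close>
inductive removable :: "'a set \<Rightarrow> ('a \<Rightarrow> 'a \<Rightarrow> bool) \<Rightarrow> ('a \<Rightarrow> int) \<Rightarrow> bool" where
  empty: "removable {} E f"
| step: "delsave_legal V E f u W \<Longrightarrow> removable (V - {u}) E (delsave_f V E f u W)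
         \<Longrightarrow> removable V E f"

end

theory Submission
  imports Defs "HOL-Library.FuncSet" "HOL-Real_Asymp.Real_Asymp"
begin

text \<open>Let \<open>A, B\<close> be the two sides and \<open>k\<close> the subtracted term. A random sparse set \<open>S \<subseteq> B\<close> of late
  vertices is chosen such that every vertex of \<open>A\<close> still has more than \<open>k\<close> late neighbours; then only
  the late vertices ever need to be saved, namely \<open>k + 1\<close> times each. The vertices of \<open>A\<close> are
  deleted first, in random order, while \<open>B\<close> is intact, so they keep their full values of order \<open>\<alpha> d\<close>.
  When a fraction \<open>x\<close> of \<open>A\<close> remains, the vertices of \<open>B\<close> have values of order at most \<open>x d\<close>, so each
  deletion can pay for about \<open>\<alpha> / x\<close> saves; integrating \<open>1 / x\<close> between two powers of \<open>d\<close>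
  yields the logarithmic factor. Just before the fraction left in \<open>A\<close> becomes critical, \<open>B - S\<close> is
  deleted, then the rest of \<open>A\<close>, and finally the independent set \<open>S\<close>. Since the number of vertices is
  not bounded in terms of \<open>d\<close>, the random choices are controlled by the local lemma.\<close>

section \<open>Local lemma and balanced colourings\<close>

text \<open>Induction on \<open>card T\<close> shows that, among the points avoiding all bad events
  in \<open>T\<close>, a share of at most \<open>2 * p\<close> lies in \<open>bad i\<close>. This is
  the symmetric local lemma, phrased with cardinalities so that no conditional probability has to be
  formed.\<close>

lemma lovasz_local_counting:
  fixes \<Omega> :: "'w set" and bad :: "'i \<Rightarrow> 'w \<Rightarrow> bool" and p :: real
  assumes fin\<Omega>: "finite \<Omega>" and ne: "\<Omega> \<noteq> {}" and finI: "finite I" and p0: "0 \<le> p"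
    and \<Gamma>: "\<And>i. i \<in> I \<Longrightarrow> finite (\<Gamma> i) \<and> i \<in> \<Gamma> i \<and> 4 * p * real (card (\<Gamma> i)) \<le> 1"
    and indep: "\<And>i T. i \<in> I \<Longrightarrow> T \<subseteq> I - \<Gamma> i \<Longrightarrow>
        real (card {\<omega>\<in>\<Omega>. bad i \<omega> \<and> (\<forall>l\<in>T. \<not> bad l \<omega>)}) \<le> p * real (card {\<omega>\<in>\<Omega>. \<forall>l\<in>T. \<not> bad l \<omega>})"
  shows "\<exists>\<omega>\<in>\<Omega>. \<forall>i\<in>I. \<not> bad i \<omega>"
proof -
  define good where "good T = {\<omega>\<in>\<Omega>. \<forall>l\<in>T. \<not> bad l \<omega>}" for T
  define bg where "bg i T = {\<omega>\<in>\<Omega>. bad i \<omega> \<and> (\<forall>l\<in>T. \<not> bad l \<omega>)}" for i T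
  have fing: "finite (good T)" "finite (bg i T)" for T i
    using fin\<Omega> by (auto simp: good_def bg_def)
  have key: "real (card (bg i T)) \<le> 2 * p * real (card (good T))" if "i \<in> I" "T \<subseteq> I" for i T
    using that
  proof (induction "card T" arbitrary: i T rule: less_induct)
    case less
    have finT: "finite T" using less.prems finI finite_subset by blast
    define T1 where "T1 = T \<inter> \<Gamma> i"
    define T2 where "T2 = T - \<Gamma> i"
    have T2: "real (card (bg i T2)) \<le> p * real (card (good T2))"
      using indep[OF less.prems(1), of T2] less.prems(2) by (auto simp: T2_def good_def bg_def)
    have "card (bg i T) \<le> card (bg i T2)"
      by (rule card_mono[OF fing(2)]) (auto simp: bg_def T2_def)
    hence 1: "real (card (bg i T)) \<le> p * real (card (good T2))" using T2 by linarith
    show ?case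
    proof (cases "T1 = {}")
      case True
      hence "T2 = T" by (auto simp: T1_def T2_def)
      thus ?thesis using 1 p0 by (simp add: mult_right_mono)
    next
      case False
      have "T2 \<subset> T" using False by (auto simp: T1_def T2_def)
      hence lt: "card T2 < card T" using finT psubset_card_mono by blast
      \<comment> \<open>The set \<open>T2\<close> is strictly smaller than \<open>T\<close>, so by
        induction each event of \<open>T1\<close> takes a share of at most \<open>2 * p\<close> of
        \<open>good T2\<close>. There are at most \<open>card (\<Gamma> i)\<close> of them, so
        together they take at most half, and passing from \<open>T2\<close> to \<open>T\<close>
        costs a factor 2.\<close>
      have sub: "good T2 \<subseteq> good T \<union> (\<Union>l\<in>T1. bg l T2)"
        by (auto simp: good_def bg_def T1_def T2_def)
      have finT1: "finite T1" using finT by (simp add: T1_def)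
      have "card (good T2) \<le> card (good T \<union> (\<Union>l\<in>T1. bg l T2))"
        by (rule card_mono[OF _ sub]) (use fing finT1 in auto)
      also have "\<dots> \<le> card (good T) + card (\<Union>l\<in>T1. bg l T2)" by (rule card_Un_le)
      also have "\<dots> \<le> card (good T) + (\<Sum>l\<in>T1. card (bg l T2))"
        using card_UN_le[OF finT1] by simp
      finally have "real (card (good T2)) \<le> real (card (good T)) + (\<Sum>l\<in>T1. real (card (bg l T2)))"
        by (metis of_nat_add of_nat_le_iff of_nat_sum)
      also have "(\<Sum>l\<in>T1. real (card (bg l T2))) \<le> (\<Sum>l\<in>T1. 2 * p * real (card (good T2)))"
        using less.prems(2) by (intro sum_mono less.hyps[OF lt]) (auto simp: T1_def T2_def)
      also have "\<dots> = real (card T1) * (2 * p * real (card (good T2)))" by simp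
      also have "\<dots> \<le> real (card (\<Gamma> i)) * (2 * p * real (card (good T2)))"
        using \<Gamma>[OF less.prems(1)] p0 by (intro mult_right_mono) (auto simp: T1_def intro!: card_mono)
      also have "\<dots> = (4 * p * real (card (\<Gamma> i))) * (real (card (good T2)) / 2)" by simp
      also have "\<dots> \<le> 1 * (real (card (good T2)) / 2)"
        using \<Gamma>[OF less.prems(1)] by (intro mult_right_mono) auto
      finally have "real (card (good T2)) \<le> 2 * real (card (good T))" by simp
      hence "p * real (card (good T2)) \<le> p * (2 * real (card (good T)))" using p0 by (rule mult_left_mono)
      thus ?thesis using 1 by simp
    qed
  qed
  \<comment> \<open>Adding the events one at a time, each step keeps at least half of the points,
    since \<open>2 * p\<close> is at most 1/2.\<close>
  have pos: "card (good T) > 0" if "finite T" "T \<subseteq> I" for T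
    using that
  proof (induction T rule: finite_induct)
    case empty
    thus ?case using fin\<Omega> ne by (simp add: good_def card_gt_0_iff)
  next
    case (insert i T)
    have "card (\<Gamma> i) > 0" using \<Gamma>[of i] insert.prems by (auto simp: card_gt_0_iff)
    hence "4 * p * 1 \<le> 4 * p * real (card (\<Gamma> i))" using p0 by (intro mult_left_mono) auto
    hence p14: "p \<le> 1 / 4" using \<Gamma>[of i] insert.prems by auto
    have "good T \<subseteq> good (insert i T) \<union> bg i T" by (auto simp: good_def bg_def)
    hence "card (good T) \<le> card (good (insert i T)) + card (bg i T)"
      by (meson card_Un_le card_mono fing finite_UnI le_trans)
    moreover have "real (card (bg i T)) \<le> 2 * p * real (card (good T))"
      using key insert.prems by auto
    moreover have "2 * p * real (card (good T)) \<le> 1/2 * real (card (good T))"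
      using p14 by (intro mult_right_mono) auto
    ultimately have "real (card (good T)) \<le> 2 * real (card (good (insert i T)))" by linarith
    moreover have "card (good T) > 0" using insert by auto
    ultimately show ?case by linarith
  qed
  from pos[OF finI] obtain \<omega> where "\<omega> \<in> good I" by (auto simp: card_gt_0_iff)
  thus ?thesis by (auto simp: good_def)
qed

text \<open>Exchanging the coordinates outside \<open>F\<close> between two functions is an
  involution on pairs; it moves the condition \<open>Q\<close> from the first function to the second
  and leaves \<open>P\<close> where it is. This is independence of events that depend on disjoint
  sets of coordinates, without denominators.\<close>

lemma card_PiE_independent:
  fixes B :: "'x \<Rightarrow> 'c set"
  assumes P: "\<And>f g. (\<And>x. x \<in> F \<Longrightarrow> f x = g x) \<Longrightarrow> P f = P g"
    and Q: "\<And>f g. (\<And>x. x \<notin> F \<Longrightarrow> f x = g x) \<Longrightarrow> Q f = Q g"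
  shows "card {f\<in>Pi\<^sub>E X B. P f \<and> Q f} * card (Pi\<^sub>E X B)
           = card {f\<in>Pi\<^sub>E X B. P f} * card {f\<in>Pi\<^sub>E X B. Q f}"
proof -
  define m where "m f g = (\<lambda>x. if x \<in> F then f x else g x)" for f g :: "'x \<Rightarrow> 'c"
  define \<Phi> where "\<Phi> = (\<lambda>(f, g). (m f g, m g f))"
  have m: "m f g \<in> Pi\<^sub>E X B" if "f \<in> Pi\<^sub>E X B" "g \<in> Pi\<^sub>E X B" for f g
    using that by (auto simp: m_def PiE_def extensional_def)
  have inv: "m (m f g) (m g f) = f" for f g by (auto simp: m_def)
  have Pm: "P (m f g) = P f" for f g by (rule P) (simp add: m_def)
  have Qm: "Q (m f g) = Q g" for f g by (rule Q) (simp add: m_def)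
  have bij: "bij_betw \<Phi> ({f\<in>Pi\<^sub>E X B. P f \<and> Q f} \<times> Pi\<^sub>E X B) ({f\<in>Pi\<^sub>E X B. P f} \<times> {f\<in>Pi\<^sub>E X B. Q f})"
    by (rule bij_betw_byWitness[where f' = \<Phi>]) (simp_all add: \<Phi>_def inv split_def image_subset_iff Pm Qm m)
  show ?thesis using bij_betw_same_card[OF bij] by (simp only: card_cartesian_product)
qed

text \<open>The sum factorises over the coordinates: up to normalisation it is the probability
  generating function of a binomial variable with \<open>card F\<close> trials of success
  probability \<open>card C / N\<close>.\<close>

lemma sum_power_hits:
  fixes t :: real
  assumes X: "finite X" and F: "F \<subseteq> X" and C: "C \<subseteq> {..<N}" and N: "N > 0"
  shows "(\<Sum>g\<in>X \<rightarrow>\<^sub>E {..<N}. t ^ card {x\<in>F. g x \<in> C})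
     = (1 + (t - 1) * (real (card C) / real N)) ^ card F * real (card (X \<rightarrow>\<^sub>E {..<N}))"
proof -
  have finF: "finite F" using X F finite_subset by blast
  have "t ^ card {x\<in>F. g x \<in> C} = (\<Prod>x\<in>X. if x \<in> F \<and> g x \<in> C then t else 1)" for g
  proof -
    have "(\<Prod>x\<in>X. if x \<in> F \<and> g x \<in> C then t else 1) = (\<Prod>x\<in>{x\<in>X. x \<in> F \<and> g x \<in> C}. t)"
      using X by (simp add: prod.If_cases Int_def)
    also have "{x\<in>X. x \<in> F \<and> g x \<in> C} = {x\<in>F. g x \<in> C}" using F by auto
    finally show ?thesis by simp
  qed
  hence "(\<Sum>g\<in>X \<rightarrow>\<^sub>E {..<N}. t ^ card {x\<in>F. g x \<in> C})
     = (\<Sum>g\<in>X \<rightarrow>\<^sub>E {..<N}. \<Prod>x\<in>X. if x \<in> F \<and> g x \<in> C then t else 1)" by simp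
  also have "\<dots> = (\<Prod>x\<in>X. \<Sum>c<N. if x \<in> F \<and> c \<in> C then t else 1)"
    using prod_sum_PiE[OF X, of "\<lambda>_. {..<N}" "\<lambda>x c. if x \<in> F \<and> c \<in> C then t else 1"] by simp
  also have "\<dots> = (\<Prod>x\<in>X. (if x \<in> F then 1 + (t - 1) * (real (card C) / real N) else 1) * real N)"
  proof (rule prod.cong[OF refl])
    fix x
    have "(\<Sum>c<N. if c \<in> C then t else 1) = (\<Sum>c<N. 1 + (if c \<in> C then t - 1 else 0))"
      by (intro sum.cong) auto
    also have "\<dots> = real N + (\<Sum>c\<in>{..<N} \<inter> C. t - 1)"
      by (simp add: sum.distrib flip: sum.inter_restrict)
    also have "{..<N} \<inter> C = C" using C by auto
    also have "real N + (\<Sum>c\<in>C. t - 1) = (1 + (t - 1) * (real (card C) / real N)) * real N"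
      using N by (simp add: field_simps)
    finally show "(\<Sum>c<N. if x \<in> F \<and> c \<in> C then t else 1)
        = (if x \<in> F then 1 + (t - 1) * (real (card C) / real N) else 1) * real N"
      by simp
  qed
  also have "\<dots> = (\<Prod>x\<in>X. if x \<in> F then 1 + (t - 1) * (real (card C) / real N) else 1) * real N ^ card X"
    by (simp add: prod.distrib)
  also have "(\<Prod>x\<in>X. if x \<in> F then 1 + (t - 1) * (real (card C) / real N) else 1)
     = (1 + (t - 1) * (real (card C) / real N)) ^ card F"
    using X F by (simp add: prod.If_cases Int_absorb1)
  finally show ?thesis using X by (simp add: card_PiE)
qed

text \<open>Markov's inequality for \<open>t ^ X\<close>; the lower bound \<open>r\<close> is left
  abstract so that \<open>t > 1\<close> serves the upper tail and \<open>t < 1\<close> the lower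
  one.\<close>

lemma exponential_markov:
  fixes X :: "'x \<Rightarrow> nat" and t r :: real
  assumes "finite S" and "0 < t" and "A \<subseteq> S" and "\<And>g. g \<in> A \<Longrightarrow> r \<le> t ^ X g"
  shows "r * real (card A) \<le> (\<Sum>g\<in>S. t ^ X g)"
proof -
  have "r * real (card A) = (\<Sum>g\<in>A. r)" by simp
  also have "\<dots> \<le> (\<Sum>g\<in>A. t ^ X g)" using assms by (intro sum_mono) auto
  also have "\<dots> \<le> (\<Sum>g\<in>S. t ^ X g)" using assms by (intro sum_mono2) auto
  finally show ?thesis .
qed

lemma ln2_bounds: "1 / 2 \<le> ln (2::real)" "ln (2::real) \<le> 1"
proof -
  have "exp (1/2) * exp (1/2) = exp (1::real)" by (simp flip: exp_add)
  hence "exp (1/2) ^ 2 \<le> (2::real) ^ 2" using exp_le by (simp add: power2_eq_square)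
  hence "exp (1/2) \<le> (2::real)" by (rule power2_le_imp_le) simp
  thus "1 / 2 \<le> ln (2::real)" by (subst ln_ge_iff) auto
  show "ln (2::real) \<le> 1" using ln_le_minus_one[of 2] by simp
qed

text \<open>Chernoff bound with base 2: the mean of \<open>2 ^ X\<close> is at most
  \<open>exp \<mu>\<close>, while \<open>X > 3 * \<mu>\<close> forces \<open>2 ^ X\<close> above
  \<open>exp (5/4 * \<mu>)\<close> because \<open>ln 2\<close> is at least 1/2.\<close>

lemma hits_upper_tail:
  assumes X: "finite X" and F: "F \<subseteq> X" and C: "C \<subseteq> {..<N}" and N: "N > 0"
  defines "\<mu> \<equiv> real (card F) * real (card C) / real N"
  shows "real (card {g\<in>X \<rightarrow>\<^sub>E {..<N}. real (card {x\<in>F. g x \<in> C}) > 3 * \<mu>})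
      \<le> exp (- \<mu> / 4) * real (card (X \<rightarrow>\<^sub>E {..<N}))"
proof -
  let ?\<Omega> = "X \<rightarrow>\<^sub>E {..<N}"
  have \<mu>0: "\<mu> \<ge> 0" by (simp add: \<mu>_def)
  have "exp (5/4 * \<mu>) * real (card {g\<in>?\<Omega>. real (card {x\<in>F. g x \<in> C}) > 3 * \<mu>})
      \<le> (\<Sum>g\<in>?\<Omega>. 2 ^ card {x\<in>F. g x \<in> C})"
  proof (rule exponential_markov)
    fix g assume "g \<in> {g\<in>?\<Omega>. real (card {x\<in>F. g x \<in> C}) > 3 * \<mu>}"
    hence "3 * \<mu> * (1/2) \<le> real (card {x\<in>F. g x \<in> C}) * ln 2"
      using \<mu>0 ln2_bounds by (intro mult_mono) auto
    hence "5/4 * \<mu> \<le> real (card {x\<in>F. g x \<in> C}) * ln 2" using \<mu>0 by linarith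
    hence "exp (5/4 * \<mu>) \<le> exp (real (card {x\<in>F. g x \<in> C}) * ln 2)" by simp
    also have "\<dots> = 2 ^ card {x\<in>F. g x \<in> C}" by (simp add: exp_of_nat_mult)
    finally show "exp (5/4 * \<mu>) \<le> 2 ^ card {x\<in>F. g x \<in> C}" .
  qed (use X in \<open>auto intro: finite_PiE\<close>)
  also have "\<dots> = (1 + real (card C) / real N) ^ card F * real (card ?\<Omega>)"
    using sum_power_hits[OF X F C N, of 2] by simp
  also have "\<dots> \<le> exp (real (card C) / real N) ^ card F * real (card ?\<Omega>)"
    by (intro mult_right_mono power_mono) auto
  also have "exp (real (card C) / real N) ^ card F = exp \<mu>"
    by (simp add: \<mu>_def flip: exp_of_nat_mult)
  also have "exp \<mu> = exp (5/4 * \<mu>) * exp (- \<mu> / 4)" by (simp flip: exp_add)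
  finally show ?thesis by (simp add: mult.assoc)
qed

text \<open>Chernoff bound with base 1/2: the mean of \<open>(1/2) ^ X\<close> is at most
  \<open>exp (- \<mu> / 2)\<close>, while \<open>X < \<mu> / 4\<close> forces it above
  \<open>exp (- \<mu> / 4)\<close> because \<open>ln 2\<close> is at most 1.\<close>

lemma hits_lower_tail:
  assumes X: "finite X" and F: "F \<subseteq> X" and C: "C \<subseteq> {..<N}" and N: "N > 0"
  defines "\<mu> \<equiv> real (card F) * real (card C) / real N"
  shows "real (card {g\<in>X \<rightarrow>\<^sub>E {..<N}. real (card {x\<in>F. g x \<in> C}) < \<mu> / 4})
      \<le> exp (- \<mu> / 4) * real (card (X \<rightarrow>\<^sub>E {..<N}))"
proof -
  let ?\<Omega> = "X \<rightarrow>\<^sub>E {..<N}"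
  have \<mu>0: "\<mu> \<ge> 0" by (simp add: \<mu>_def)
  have "card C \<le> N" using card_mono[OF _ C] by simp
  hence q1: "real (card C) / real N \<le> 1" using N by simp
  have "exp (- \<mu> / 4) * real (card {g\<in>?\<Omega>. real (card {x\<in>F. g x \<in> C}) < \<mu> / 4})
      \<le> (\<Sum>g\<in>?\<Omega>. (1/2) ^ card {x\<in>F. g x \<in> C})"
  proof (rule exponential_markov)
    fix g assume "g \<in> {g\<in>?\<Omega>. real (card {x\<in>F. g x \<in> C}) < \<mu> / 4}"
    hence "real (card {x\<in>F. g x \<in> C}) * ln 2 \<le> \<mu> / 4 * 1"
      using \<mu>0 ln2_bounds by (intro mult_mono) auto
    hence "exp (- \<mu> / 4) \<le> exp (real (card {x\<in>F. g x \<in> C}) * (- ln 2))" by simp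
    also have "\<dots> = (1/2) ^ card {x\<in>F. g x \<in> C}"
      by (subst exp_of_nat_mult) (simp add: exp_minus inverse_eq_divide)
    finally show "exp (- \<mu> / 4) \<le> (1/2) ^ card {x\<in>F. g x \<in> C}" .
  qed (use X in \<open>auto intro: finite_PiE\<close>)
  also have "\<dots> = (1 + (- (real (card C) / real N) / 2)) ^ card F * real (card ?\<Omega>)"
    using sum_power_hits[OF X F C N, of "1/2"] by (simp add: mult.commute)
  also have "\<dots> \<le> exp (- (real (card C) / real N) / 2) ^ card F * real (card ?\<Omega>)"
    by (intro mult_right_mono power_mono exp_ge_add_one_self) (use q1 in auto)
  also have "exp (- (real (card C) / real N) / 2) ^ card F = exp (- \<mu> / 2)"
    by (simp add: \<mu>_def flip: exp_of_nat_mult)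
  also have "exp (- \<mu> / 2) = exp (- \<mu> / 4) * exp (- \<mu> / 4)" by (simp flip: exp_add)
  finally show ?thesis by (simp add: mult.assoc)
qed

text \<open>In a uniform random colouring each index fails with probability at most
  \<open>2 * exp (- \<mu> / 4)\<close>, and it depends only on the indices whose sets meet
  \<open>F i\<close>. The logarithmic lower bound on the mean lets the local lemma apply, however
  large \<open>X\<close> is.\<close>

lemma balanced_colouring:
  fixes F :: "'i \<Rightarrow> 'x set" and C :: "'i \<Rightarrow> nat set" and D N :: nat
  assumes X: "finite X" and I: "finite I" and N: "N > 0" and D: "D > 0"
    and F: "\<And>i. i \<in> I \<Longrightarrow> F i \<subseteq> X \<and> card (F i) \<le> D"
    and deg: "\<And>x. x \<in> X \<Longrightarrow> card {i\<in>I. x \<in> F i} \<le> D"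
    and C: "\<And>i. i \<in> I \<Longrightarrow> C i \<subseteq> {..<N}"
    and \<mu>: "\<And>i. i \<in> I \<Longrightarrow> 4 * ln (8 * real D ^ 2) \<le> real (card (F i)) * real (card (C i)) / real N"
  shows "\<exists>g\<in>X \<rightarrow>\<^sub>E {..<N}. \<forall>i\<in>I.
     real (card (F i)) * real (card (C i)) / real N / 4 \<le> real (card {x\<in>F i. g x \<in> C i}) \<and>
     real (card {x\<in>F i. g x \<in> C i}) \<le> 3 * (real (card (F i)) * real (card (C i)) / real N)"
proof -
  let ?\<Omega> = "X \<rightarrow>\<^sub>E {..<N}"
  define \<mu>' where "\<mu>' i = real (card (F i)) * real (card (C i)) / real N" for i
  define bad where "bad i g \<longleftrightarrow> real (card {x\<in>F i. g x \<in> C i}) < \<mu>' i / 4 \<or>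
     real (card {x\<in>F i. g x \<in> C i}) > 3 * \<mu>' i" for i and g :: "'x \<Rightarrow> nat"
  \<comment> \<open>The two tails together have probability at most \<open>2 / (8 * D^2)\<close>,
    which is \<open>p\<close>; as \<open>\<Gamma> i\<close> has at most \<open>D * D\<close>
    members, \<open>4 * p * card (\<Gamma> i)\<close> is at most 1.\<close>
  define p where "p = 1 / (4 * real D ^ 2)"
  define \<Gamma> where "\<Gamma> i = {l\<in>I. F l \<inter> F i \<noteq> {}}" for i
  have fin\<Omega>: "finite ?\<Omega>" using X by (intro finite_PiE) auto
  have ne: "?\<Omega> \<noteq> {}" using N by (auto simp: PiE_eq_empty_iff)
  have \<Omega>0: "card ?\<Omega> > 0" using fin\<Omega> ne by (simp add: card_gt_0_iff)
  have cardbad: "real (card {g\<in>?\<Omega>. bad i g}) \<le> p * real (card ?\<Omega>)" if i: "i \<in> I" for i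
  proof -
    let ?L = "{g\<in>?\<Omega>. real (card {x\<in>F i. g x \<in> C i}) < \<mu>' i / 4}"
    let ?U = "{g\<in>?\<Omega>. real (card {x\<in>F i. g x \<in> C i}) > 3 * \<mu>' i}"
    have eq: "{g\<in>?\<Omega>. bad i g} = ?L \<union> ?U" by (auto simp: bad_def)
    have "card {g\<in>?\<Omega>. bad i g} \<le> card ?L + card ?U" unfolding eq by (rule card_Un_le)
    hence "real (card {g\<in>?\<Omega>. bad i g}) \<le> real (card ?L) + real (card ?U)" by linarith
    also have "\<dots> \<le> exp (- \<mu>' i / 4) * real (card ?\<Omega>) + exp (- \<mu>' i / 4) * real (card ?\<Omega>)"
      unfolding \<mu>'_def using F[OF i] C[OF i] X N
      by (intro add_mono hits_lower_tail hits_upper_tail) auto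
    also have "\<dots> = 2 * exp (- \<mu>' i / 4) * real (card ?\<Omega>)" by simp
    also have "exp (- \<mu>' i / 4) \<le> exp (- ln (8 * real D ^ 2))"
      using \<mu>[OF i] by (simp add: \<mu>'_def)
    also have "exp (- ln (8 * real D ^ 2)) = 1 / (8 * real D ^ 2)"
      using D by (simp add: exp_minus inverse_eq_divide)
    finally show ?thesis by (simp add: p_def mult_right_mono)
  qed
  have nonempty: "F i \<noteq> {}" if "i \<in> I" for i
  proof -
    have "real D ^ 2 \<ge> 1" using D by simp
    hence "ln (8 * real D ^ 2) > 0" by (intro ln_gt_zero) linarith
    hence "real (card (F i)) * real (card (C i)) / real N > 0" using \<mu>[OF that] by linarith
    thus ?thesis by auto
  qed
  have "\<exists>g\<in>?\<Omega>. \<forall>i\<in>I. \<not> bad i g"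
  proof (rule lovasz_local_counting[OF fin\<Omega> ne I])
    show "0 \<le> p" by (simp add: p_def)
  next
    fix i assume i: "i \<in> I"
    have finFi: "finite (F i)" using F[OF i] X finite_subset by blast
    have eq: "\<Gamma> i = (\<Union>x\<in>F i. {l\<in>I. x \<in> F l})" by (auto simp: \<Gamma>_def)
    have "card (\<Gamma> i) \<le> (\<Sum>x\<in>F i. card {l\<in>I. x \<in> F l})" unfolding eq by (rule card_UN_le[OF finFi])
    also have "\<dots> \<le> (\<Sum>x\<in>F i. D)" using F[OF i] by (intro sum_mono deg) auto
    also have "\<dots> \<le> D * D" using F[OF i] by simp
    finally have "real (card (\<Gamma> i)) \<le> real D ^ 2" by (metis of_nat_le_iff of_nat_power power2_eq_square)
    thus "finite (\<Gamma> i) \<and> i \<in> \<Gamma> i \<and> 4 * p * real (card (\<Gamma> i)) \<le> 1"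
      using i I D nonempty[OF i] by (auto simp: \<Gamma>_def p_def field_simps)
  next
    fix i T assume i: "i \<in> I" and T: "T \<subseteq> I - \<Gamma> i"
    have "card {g\<in>?\<Omega>. bad i g \<and> (\<forall>l\<in>T. \<not> bad l g)} * card ?\<Omega>
        = card {g\<in>?\<Omega>. bad i g} * card {g\<in>?\<Omega>. \<forall>l\<in>T. \<not> bad l g}"
    proof (rule card_PiE_independent[where F = "F i"])
      fix f g :: "'x \<Rightarrow> nat" assume eq: "\<And>x. x \<in> F i \<Longrightarrow> f x = g x"
      have "{x\<in>F i. f x \<in> C i} = {x\<in>F i. g x \<in> C i}" using eq by auto
      thus "bad i f = bad i g" by (simp add: bad_def)
    next
      fix f g :: "'x \<Rightarrow> nat" assume eq: "\<And>x. x \<notin> F i \<Longrightarrow> f x = g x"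
      have "{x\<in>F l. f x \<in> C l} = {x\<in>F l. g x \<in> C l}" if "l \<in> T" for l
      proof -
        have "F l \<inter> F i = {}" using T that by (auto simp: \<Gamma>_def)
        thus ?thesis using eq by force
      qed
      thus "(\<forall>l\<in>T. \<not> bad l f) = (\<forall>l\<in>T. \<not> bad l g)" by (simp add: bad_def)
    qed
    hence "real (card {g\<in>?\<Omega>. bad i g \<and> (\<forall>l\<in>T. \<not> bad l g)}) * real (card ?\<Omega>)
        = real (card {g\<in>?\<Omega>. bad i g}) * real (card {g\<in>?\<Omega>. \<forall>l\<in>T. \<not> bad l g})"
      by (simp only: flip: of_nat_mult)
    also have "\<dots> \<le> p * real (card ?\<Omega>) * real (card {g\<in>?\<Omega>. \<forall>l\<in>T. \<not> bad l g})"
      by (intro mult_right_mono cardbad i) simp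
    finally show "real (card {g\<in>?\<Omega>. bad i g \<and> (\<forall>l\<in>T. \<not> bad l g)})
        \<le> p * real (card {g\<in>?\<Omega>. \<forall>l\<in>T. \<not> bad l g})"
      using \<Omega>0 by (simp add: mult.commute mult.left_commute)
  qed
  then obtain g where "g \<in> ?\<Omega>" and "\<forall>i\<in>I. \<not> bad i g" by blast
  thus ?thesis unfolding bad_def \<mu>'_def de_Morgan_disj not_less by blast
qed

section \<open>The deletion process\<close>

text \<open>Deletions read \<open>f\<close> only on the current vertex set. This absorbs the value
  at a vertex just deleted, where \<open>delsave_f\<close> and a closed form of the state need not
  agree.\<close>

lemma removable_cong:
  assumes "removable V E f" and "\<And>x. x \<in> V \<Longrightarrow> f x = g x"
  shows "removable V E g"
  using assms
proof (induction arbitrary: g rule: removable.induct)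
  case (empty E f)
  show ?case by (rule removable.empty)
next
  case (step V E f u W)
  have upd: "delsave_f V E f u W x = delsave_f V E g u W x" if "x \<in> V" for x
    using step.prems that by (simp add: delsave_f_def)
  have W: "W \<subseteq> V" using step.hyps(1) by (auto simp: delsave_legal_def nbr_def)
  have "sum f W = sum g W" using W step.prems by (intro sum.cong) auto
  hence "delsave_legal V E g u W"
    using step.hyps(1) step.prems upd by (auto simp: delsave_legal_def)
  thus ?case by (rule removable.step) (rule step.IH, use upd in auto)
qed

text \<open>The deletion order is: \<^term>\<open>A - A\<^sub>0\<close> by decreasing \<^term>\<open>g\<close>, then
  \<^term>\<open>B - S\<close>, then \<^term>\<open>A\<^sub>0\<close>, then \<^term>\<open>S\<close>; this is the order of the \<open>key\<close> below.
  A vertex \<^term>\<open>u\<close> saves the members of \<^term>\<open>M u\<close> that have been saved at most \<^term>\<open>k\<close> times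
  so far. The cap keeps the current value of a saved vertex below its remaining degree, which is what
  \<^term>\<open>r u\<close> bounds.\<close>

lemma removable_by_saving:
  fixes V :: "'a set" and g :: "'a \<Rightarrow> nat" and M :: "'a \<Rightarrow> 'a set" and r :: "'a \<Rightarrow> real"
  assumes G: "simple_graph V E"
    and AB: "A \<union> B = V" "A \<inter> B = {}"
    and bip: "\<And>x y. E x y \<Longrightarrow> x \<in> A \<longleftrightarrow> y \<in> B"
    and SB: "S \<subseteq> B"
    and gN: "\<And>u. u \<in> A \<Longrightarrow> g u < N"
    and A0: "A\<^sub>0 = {u\<in>A. g u = 0}"
    and M: "\<And>u. M u \<subseteq> nbr V E u \<inter> S" "\<And>u. u \<notin> A - A\<^sub>0 \<Longrightarrow> M u = {}"
    and toS: "\<And>u. u \<in> A \<Longrightarrow> k + 1 \<le> card (nbr V E u \<inter> S)"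
    and toA0: "\<And>w. w \<in> B \<Longrightarrow> k + 1 \<le> card (nbr V E w \<inter> A\<^sub>0)"
    and r: "\<And>u w. u \<in> A - A\<^sub>0 \<Longrightarrow> w \<in> M u \<Longrightarrow> real (card {x \<in> nbr V E w. g x \<le> g u}) \<le> r u"
    and cap: "\<And>u. u \<in> A - A\<^sub>0 \<Longrightarrow> real (card (M u)) * r u < real (deg V E u) - real k"
    and saves: "\<And>w. w \<in> S \<Longrightarrow> k + 1 \<le> card {u\<in>A. w \<in> M u}"
  shows "removable V E (\<lambda>v. int (deg V E v) - int k)"
proof -
  have finV: "finite V" and symE: "E x y \<Longrightarrow> E y x" and EV: "E x y \<Longrightarrow> x \<in> V \<and> y \<in> V" for x y
    using G unfolding simple_graph_def by blast+
  have fin: "finite A" "finite B" "finite S" using finV AB SB by (auto intro: finite_subset)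
  define cnt where "cnt U v = card {u\<in>A - U. v \<in> M u}" for U v
  \<comment> \<open>Closed form of the current value when \<open>U\<close> is left: every deleted
    neighbour costs 1 unless it saved \<open>v\<close>, and exactly the first \<open>k + 1\<close>
    of the \<open>cnt U v\<close> chances to save \<open>v\<close> are used. The state thus depends
    on \<open>U\<close> alone.\<close>
  define st where "st U v = int (deg U E v) - int k + int (min (k + 1) (cnt U v))" for U v
  define key where "key v = (if v \<in> A - A\<^sub>0 then N - g v else if v \<in> B - S then N + 1
      else if v \<in> A\<^sub>0 then N + 2 else N + 3)" for v
  \<comment> \<open>These sets contain all that can remain when vertices are deleted by
    nondecreasing \<open>key\<close>, with ties broken arbitrarily.\<close>
  define up where "up U \<longleftrightarrow> U \<subseteq> V \<and> (\<forall>x\<in>U. \<forall>y\<in>V - U. key y \<le> key x)" for U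
  have upD: "y \<in> U" if "up U" "x \<in> U" "y \<in> V" "key x < key y" for U x y
  proof (rule ccontr)
    assume "y \<notin> U"
    hence "key y \<le> key x" using that(1-3) unfolding up_def by blast
    thus False using that(4) by simp
  qed
  have degU: "deg U E x \<ge> card (nbr V E x \<inter> T)" if "nbr V E x \<inter> T \<subseteq> U" "U \<subseteq> V" for U x T
    unfolding deg_def using that finV
    by (intro card_mono) (auto simp: nbr_def intro: finite_subset)
  have nbrA: "nbr V E x \<subseteq> B" if "x \<in> A" for x using that bip by (auto simp: nbr_def)
  have nbrB: "nbr V E x \<subseteq> A" if "x \<in> B" for x
  proof
    fix y assume "y \<in> nbr V E x"
    hence "E y x" using symE by (simp add: nbr_def)
    thus "y \<in> A" using bip that by blast
  qed
  have BU: "B \<subseteq> U" if "up U" "x \<in> U" "x \<in> A - A\<^sub>0" for U x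
  proof
    fix y assume y: "y \<in> B"
    have "key x \<le> N" using that by (simp add: key_def)
    moreover have "key y > N" using y AB A0 by (auto simp: key_def)
    ultimately show "y \<in> U" using y AB(1) by (intro upD[OF that(1,2)]) auto
  qed
  \<comment> \<open>A value stays positive while \<open>k + 1\<close> neighbours in a later class
    remain: \<open>A\<close> relies on \<open>S\<close>, and \<open>B - S\<close> relies on
    \<open>A\<^sub>0\<close>. A vertex of \<open>S\<close> relies on \<open>A\<^sub>0\<close> at
    first and on its completed saves afterwards.\<close>
  have pos: "st U x \<ge> 1" if U: "up U" and x: "x \<in> U" for U x
  proof -
    have UV: "U \<subseteq> V" using U by (simp add: up_def)
    have degI: "st U x \<ge> 1" if "k + 1 \<le> deg U E x" using that by (simp add: st_def)
    consider "x \<in> A - A\<^sub>0" | "x \<in> A\<^sub>0" | "x \<in> B - S" | "x \<in> S" using x UV AB by auto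
    thus ?thesis
    proof cases
      case 1
      hence sub: "nbr V E x \<inter> S \<subseteq> U" using BU[OF U x] SB by auto
      show ?thesis by (rule degI, rule order_trans[OF toS degU[OF sub UV]]) (use 1 in auto)
    next
      case 2
      have "key x \<le> N + 2" using 2 by (simp add: key_def)
      moreover have "key y = N + 3" if "y \<in> S" for y using that SB AB A0 by (auto simp: key_def)
      ultimately have sub: "nbr V E x \<inter> S \<subseteq> U"
        using SB AB(1) by (auto intro!: upD[OF U x])
      show ?thesis by (rule degI, rule order_trans[OF toS degU[OF sub UV]]) (use 2 A0 in auto)
    next
      case 3
      have "key x = N + 1" using 3 A0 AB by (auto simp: key_def)
      moreover have "key y = N + 2" if "y \<in> A\<^sub>0" for y using that SB AB A0 by (auto simp: key_def)
      ultimately have sub: "nbr V E x \<inter> A\<^sub>0 \<subseteq> U"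
        using A0 AB(1) by (auto intro!: upD[OF U x])
      show ?thesis by (rule degI, rule order_trans[OF toA0 degU[OF sub UV]]) (use 3 in auto)
    next
      case 4
      show ?thesis
      proof (cases "A\<^sub>0 \<subseteq> U")
        case True
        hence sub: "nbr V E x \<inter> A\<^sub>0 \<subseteq> U" by auto
        show ?thesis by (rule degI, rule order_trans[OF toA0 degU[OF sub UV]]) (use 4 SB in auto)
      next
        case False
        \<comment> \<open>Once a vertex of \<open>A\<^sub>0\<close> is gone, so is all of
          \<open>A - A\<^sub>0\<close>. Every chance to save \<open>x\<close> has then passed, and
          its \<open>k + 1\<close> saves alone outweigh the subtracted \<open>k\<close>.\<close>
        then obtain y where y: "y \<in> A\<^sub>0" "y \<notin> U" by auto
        have ky: "key y = N + 2" using y SB AB A0 by (auto simp: key_def)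
        have "z \<notin> U" if z: "z \<in> A - A\<^sub>0" for z
        proof
          assume "z \<in> U"
          hence "key y \<le> key z" using U y A0 AB(1) by (auto simp: up_def)
          moreover have "key z \<le> N" using z by (simp add: key_def)
          ultimately show False using ky by simp
        qed
        hence "{u\<in>A. x \<in> M u} \<subseteq> {u\<in>A - U. x \<in> M u}" using M(2) by auto
        hence "card {u\<in>A. x \<in> M u} \<le> cnt U x" unfolding cnt_def using fin by (intro card_mono) auto
        hence "k + 1 \<le> cnt U x" using saves[OF 4] by simp
        thus ?thesis by (simp add: st_def)
      qed
    qed
  qed
  have main: "up U \<Longrightarrow> removable U E (st U)" for U
  proof (induction "card U" arbitrary: U rule: less_induct)
    case less
    have UV: "U \<subseteq> V" and finU: "finite U" using less.prems finV by (auto simp: up_def intro: finite_subset)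
    show ?case
    proof (cases "U = {}")
      case True
      thus ?thesis by (simp add: removable.empty)
    next
      case False
      define u where "u = arg_min_on key U"
      have u: "u \<in> U" and umin: "\<And>x. x \<in> U \<Longrightarrow> key u \<le> key x"
        unfolding u_def using finU False by (auto intro: arg_min_if_finite arg_min_least)
      define W where "W = {w\<in>M u. cnt U w \<le> k}"
      have upu: "up (U - {u})" using less.prems umin by (auto simp: up_def)
      have BUu: "B \<subseteq> U" if "M u \<noteq> {}" using BU[OF less.prems u] that M(2) by auto
      have WU: "W \<subseteq> nbr U E u" using M(1)[of u] BUu SB by (force simp: W_def nbr_def)
      \<comment> \<open>A saved neighbour loses one in degree and gains one in the capped count.
        Once its count exceeds \<open>k\<close>, the cap is reached and it decreases like any other
        neighbour.\<close>
      have upd: "delsave_f U E (st U) u W x = st (U - {u}) x" if x: "x \<in> U - {u}" for x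
      proof -
        have cnt': "cnt (U - {u}) x = (if x \<in> M u then cnt U x + 1 else cnt U x)"
        proof -
          have "{v\<in>A - (U - {u}). x \<in> M v} = (if x \<in> M u then insert u {v\<in>A - U. x \<in> M v} else {v\<in>A - U. x \<in> M v})"
            using M(2)[of u] by auto
          thus ?thesis using fin(1) u by (auto simp: cnt_def)
        qed
        have "nbr (U - {u}) E x = nbr U E x - {u}" by (auto simp: nbr_def)
        moreover have "u \<in> nbr U E x \<longleftrightarrow> E u x"
          using u symE[of u x] symE[of x u] by (auto simp: nbr_def)
        moreover have "finite (nbr U E x)" using finU by (simp add: nbr_def)
        ultimately have deg': "deg (U - {u}) E x = (if E u x then deg U E x - 1 else deg U E x)"
          and degp: "E u x \<Longrightarrow> deg U E x > 0"
          by (auto simp: deg_def card_gt_0_iff)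
        have "x \<in> M u \<Longrightarrow> E u x" using M(1)[of u] by (auto simp: nbr_def)
        thus ?thesis
          using x deg' degp cnt' by (auto simp: delsave_f_def st_def nbr_def W_def of_nat_diff)
      qed
      have sumW: "sum (st U) W < st U u"
      proof (cases "M u = {}")
        case True
        hence "W = {}" by (simp add: W_def)
        thus ?thesis using pos[OF less.prems u] by simp
      next
        case False
        hence uA: "u \<in> A - A\<^sub>0" using M(2) by blast
        have finM: "finite (M u)" using M(1)[of u] fin(3) by (auto intro: finite_subset)
        have stw: "real_of_int (st U w) \<le> r u" if w: "w \<in> W" for w
        proof -
          have wM: "w \<in> M u" "cnt U w \<le> k" using w by (auto simp: W_def)
          have wB: "w \<in> B" using wM M(1)[of u] SB by auto
          \<comment> \<open>The neighbours of \<open>w\<close> lie in \<open>A\<close>, and those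
            with larger \<open>g\<close> than \<open>u\<close> have already been deleted. The bound
            \<open>gN\<close> keeps the subtraction \<open>N - g v\<close> in \<open>key\<close>
            from truncating.\<close>
          have "nbr U E w \<subseteq> {x \<in> nbr V E w. g x \<le> g u}"
          proof
            fix x assume x: "x \<in> nbr U E w"
            hence xU: "x \<in> U" and xV: "x \<in> nbr V E w" using UV by (auto simp: nbr_def)
            have xA: "x \<in> A" using xV nbrB[OF wB] by auto
            have "key u \<le> key x" using umin xU by simp
            hence "g x \<le> g u" using uA xA A0 gN[of x] gN[of u] by (auto simp: key_def split: if_splits)
            thus "x \<in> {x \<in> nbr V E w. g x \<le> g u}" using xV by simp
          qed
          hence "deg U E w \<le> card {x \<in> nbr V E w. g x \<le> g u}"
            unfolding deg_def using finV by (intro card_mono) (auto simp: nbr_def)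
          moreover have "st U w \<le> int (deg U E w)" using wM by (simp add: st_def)
          ultimately show ?thesis using r[OF uA wM(1)] by linarith
        qed
        have r0: "r u \<ge> 0" using r[OF uA] False by (meson all_not_in_conv of_nat_0_le_iff order_trans)
        have "real_of_int (sum (st U) W) \<le> (\<Sum>w\<in>W. r u)"
          by (simp only: of_int_sum) (intro sum_mono stw)
        also have "\<dots> = real (card W) * r u" by simp
        also have "\<dots> \<le> real (card (M u)) * r u"
          using finM r0 by (intro mult_right_mono) (auto simp: W_def intro!: card_mono)
        also have "\<dots> < real (deg V E u) - real k" by (rule cap[OF uA])
        \<comment> \<open>All of \<open>B\<close> is still present when a vertex of
          \<open>A - A\<^sub>0\<close> is deleted, so it pays with its full initial degree.\<close>
        also have "deg V E u = deg U E u"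
        proof -
          have "nbr V E u \<subseteq> U" using nbrA[of u] uA BUu[OF False] by auto
          hence "nbr U E u = nbr V E u" using UV by (auto simp: nbr_def)
          thus ?thesis by (simp add: deg_def)
        qed
        finally have "sum (st U) W < int (deg U E u) - int k" by linarith
        thus ?thesis by (simp add: st_def)
      qed
      have legal: "delsave_legal U E (st U) u W"
        unfolding delsave_legal_def using u WU sumW upd pos[OF upu] by auto
      have "removable (U - {u}) E (st (U - {u}))"
        using less.hyps[OF _ upu] finU u by (meson card_Diff1_less)
      hence "removable (U - {u}) E (delsave_f U E (st U) u W)"
        by (rule removable_cong) (simp add: upd)
      thus ?thesis using legal by (rule removable.step[rotated])
    qed
  qed
  have "up V" by (simp add: up_def)
  hence "removable V E (st V)" by (rule main)
  thus ?thesis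
  proof (rule removable_cong)
    fix x assume "x \<in> V"
    have AV: "A - V = {}" using AB by auto
    have "cnt V x = 0" unfolding cnt_def AV by simp
    thus "st V x = int (deg V E x) - int k" by (simp add: st_def)
  qed
qed

section \<open>Random late vertices, levels and saving edges\<close>

text \<open>\<^term>\<open>q\<close>: a vertex of \<open>B\<close> is late with probability \<open>2\<^sup>-\<^sup>q\<close>. A uniform colour in
  \<open>{..<2\<^sup>b}\<close> on \<open>A\<close> encodes geometric levels: level \<open>j\<close> is the colour range
  \<open>2\<^sup>b\<^sup>-\<^sup>j\<^sup>-\<^sup>1 \<le> g u < 2\<^sup>b\<^sup>-\<^sup>j\<close> (predicate \<open>dy\<close>), so when a vertex of level \<open>j\<close> is deleted
  about a fraction \<open>2\<^sup>-\<^sup>j\<close> of each neighbourhood in \<open>A\<close> is left. An edge from level \<open>j\<close> to a late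
  vertex is a saving edge with probability \<open>2\<^sup>j / 2\<^sup>t\<close>: the closer to the end, the cheaper a save is,
  and each of the \<^term>\<open>b - a\<close> levels contributes the same expected number of saves.\<close>

lemma removable_if_dyadic_parameters:
  fixes V :: "'a set" and \<alpha> :: real and a b d k q t :: nat
  assumes G: "simple_graph V E" and bipartite: "bipartite V E"
    and deg_le: "\<And>v. v \<in> V \<Longrightarrow> deg V E v \<le> d"
    and deg_ge: "\<And>v. v \<in> V \<Longrightarrow> \<alpha> * real d \<le> real (deg V E v)"
    and \<alpha>: "\<alpha> > 0" and bt: "b \<le> t" and bd: "2 * b + 1 \<le> d" and d2: "2 \<le> d"
    and log_le: "4 * ln (8 * real (d\<^sup>2) ^ 2) \<le> 4 * (real k + 1)"
    and late: "4 * (real k + 1) * 2 ^ q \<le> \<alpha> * real d"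
    and last: "4 * (real k + 1) * 2 ^ b \<le> \<alpha> * real d"
    and match_u: "4 * ln (8 * real (d\<^sup>2) ^ 2) \<le> \<alpha> * real d * 2 ^ a / (4 * 2 ^ q * 2 ^ t)"
    and match_w: "4 * ln (8 * real (d\<^sup>2) ^ 2) \<le> \<alpha> * real d / (8 * 2 ^ t)"
    and rate: "64 * real d \<le> 2 ^ q * 2 ^ t"
    and total: "real k + 1 \<le> real (b - a) * (\<alpha> * real d) / (32 * 2 ^ t)"
  shows "removable V E (\<lambda>v. int (deg V E v) - int k)"
proof -
  have finV: "finite V" and symE: "E x y \<Longrightarrow> E y x" and EV: "E x y \<Longrightarrow> x \<in> V \<and> y \<in> V" for x y
    using G unfolding simple_graph_def by blast+
  obtain A B where AB: "A \<union> B = V" "A \<inter> B = {}"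
    and AB_edge: "\<forall>x\<in>V. \<forall>y\<in>V. E x y \<longrightarrow> (x \<in> A \<and> y \<in> B) \<or> (x \<in> B \<and> y \<in> A)"
    using bipartite unfolding bipartite_def by blast
  have bip: "x \<in> A \<longleftrightarrow> y \<in> B" if "E x y" for x y
    using AB_edge EV[OF that] that AB(2) by blast
  have fin: "finite A" "finite B" using finV AB by (auto intro: finite_subset)
  have nbr_iff: "y \<in> nbr V E x \<longleftrightarrow> E x y" for x y using EV by (auto simp: nbr_def)
  have nbr_sym: "y \<in> nbr V E x \<longleftrightarrow> x \<in> nbr V E y" for x y using symE nbr_iff by blast
  have nbrA: "nbr V E x \<subseteq> B" if "x \<in> A" for x using that bip nbr_iff by blast
  have nbrB: "nbr V E x \<subseteq> A" if "x \<in> B" for x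
    using that bip nbr_iff nbr_sym by blast
  have fin_nbr: "finite (nbr V E x)" for x using finV by (simp add: nbr_def)
  have d_sq: "d \<le> d\<^sup>2" by (simp add: power2_eq_square)
  have d_sq0: "0 < d\<^sup>2" using d2 by simp
  have degA: "card (nbr V E u) \<le> d" "\<alpha> * real d \<le> real (card (nbr V E u))" if "u \<in> V" for u
    using deg_le[OF that] deg_ge[OF that] by (auto simp: deg_def)

  \<comment> \<open>The set of late vertices\<close>
  have "\<exists>c\<in>B \<rightarrow>\<^sub>E {..<(2::nat) ^ q}. \<forall>u\<in>A.
     real (card (nbr V E u)) * real (card {0::nat}) / real ((2::nat) ^ q) / 4 \<le> real (card {x\<in>nbr V E u. c x \<in> {0}}) \<and>
     real (card {x\<in>nbr V E u. c x \<in> {0}}) \<le> 3 * (real (card (nbr V E u)) * real (card {0::nat}) / real ((2::nat) ^ q))"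
  \<comment> \<open>All three colourings use \<open>D = d^2\<close>, so that they share one
    logarithmic threshold; the square leaves room for the many colour sets attached to each vertex
    in the second one.\<close>
  proof (rule balanced_colouring[where D = "d\<^sup>2"])
    show "nbr V E u \<subseteq> B \<and> card (nbr V E u) \<le> d\<^sup>2" if "u \<in> A" for u
      using nbrA[OF that] degA(1)[of u] that AB d_sq by auto
    show "card {u\<in>A. w \<in> nbr V E u} \<le> d\<^sup>2" if "w \<in> B" for w
    proof -
      have "{u\<in>A. w \<in> nbr V E u} \<subseteq> nbr V E w" using nbr_sym by blast
      hence "card {u\<in>A. w \<in> nbr V E u} \<le> card (nbr V E w)" by (rule card_mono[OF fin_nbr])
      thus ?thesis using degA(1)[of w] that AB(1) d_sq by auto
    qed
    show "4 * ln (8 * real (d\<^sup>2) ^ 2) \<le> real (card (nbr V E u)) * real (card {0::nat}) / real ((2::nat) ^ q)"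
      if "u \<in> A" for u
    proof -
      have "u \<in> V" using that AB(1) by auto
      hence "4 * (real k + 1) * 2 ^ q \<le> real (card (nbr V E u))" using degA(2) late by force
      hence "4 * (real k + 1) \<le> real (card (nbr V E u)) / 2 ^ q" by (simp add: field_simps)
      thus ?thesis using log_le by simp
    qed
  qed (use fin d_sq0 in auto)
  then obtain c\<^sub>B :: "'a \<Rightarrow> nat" where c\<^sub>B: "\<forall>u\<in>A.
      real (card (nbr V E u)) / 2 ^ q / 4 \<le> real (card {x\<in>nbr V E u. c\<^sub>B x = 0}) \<and>
      real (card {x\<in>nbr V E u. c\<^sub>B x = 0}) \<le> 3 * (real (card (nbr V E u)) / 2 ^ q)"
    by simp blast
  define S where "S = {w\<in>B. c\<^sub>B w = 0}"
  have finS: "finite S" and SB: "S \<subseteq> B" using fin by (auto simp: S_def)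
  have S: "real (card (nbr V E u)) / 2 ^ q / 4 \<le> real (card (nbr V E u \<inter> S))"
    "real (card (nbr V E u \<inter> S)) \<le> 3 * (real (card (nbr V E u)) / 2 ^ q)" if "u \<in> A" for u
  proof -
    have "nbr V E u \<inter> S = {x\<in>nbr V E u. c\<^sub>B x = 0}" using nbrA[OF that] by (auto simp: S_def)
    thus "real (card (nbr V E u)) / 2 ^ q / 4 \<le> real (card (nbr V E u \<inter> S))"
      "real (card (nbr V E u \<inter> S)) \<le> 3 * (real (card (nbr V E u)) / 2 ^ q)" using bspec[OF c\<^sub>B that] by simp_all
  qed

  \<comment> \<open>Geometric levels on \<open>A\<close>\<close>
  define Cs :: "nat set set" where "Cs = (\<lambda>j. {..<2 ^ (b - j)}) ` {..b} \<union> (\<lambda>j. {2 ^ (b - j - 1)..<2 ^ (b - j)}) ` {..<b}"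
  have finCs: "finite Cs" by (simp add: Cs_def)
  have cardCs: "card Cs \<le> 2 * b + 1"
  proof -
    have "card Cs \<le> card ((\<lambda>j. {..<2 ^ (b - j)}) ` {..b} :: nat set set)
        + card ((\<lambda>j. {2 ^ (b - j - 1)..<2 ^ (b - j)}) ` {..<b} :: nat set set)"
      unfolding Cs_def by (rule card_Un_le)
    also have "\<dots> \<le> card {..b} + card {..<b}" by (intro add_mono card_image_le) auto
    finally show ?thesis by simp
  qed
  have Cs: "C \<subseteq> {..<2 ^ b} \<and> 1 \<le> card C" if C: "C \<in> Cs" for C
  proof -
    have le: "(2::nat) ^ (b - j) \<le> 2 ^ b" for j by (intro power_increasing) auto
    have lt: "(2::nat) ^ (b - j - 1) < 2 ^ (b - j)" if "j < b" for j
      using that by (intro power_strict_increasing) auto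
    from C consider j where "C = {..<2 ^ (b - j)}"
      | j where "j < b" "C = {2 ^ (b - j - 1)..<2 ^ (b - j)}" by (auto simp: Cs_def)
    thus ?thesis
    proof cases
      case 1
      thus ?thesis using le[of j] by auto
    next
      case 2
      have "C \<subseteq> {..<2 ^ b}" using 2 le[of j] by (auto intro: less_le_trans)
      moreover have "1 \<le> card C" using lt[OF 2(1)] unfolding 2(2) card_atLeastLessThan by linarith
      ultimately show ?thesis by simp
    qed
  qed
  \<comment> \<open>The initial segments in \<open>Cs\<close> control how much of a neighbourhood is
    left, the segment for \<open>j = b\<close> being the colour 0 of \<open>A\<^sub>0\<close>. The
    half-open blocks control the size of each level from below.\<close>
  have "\<exists>c\<in>A \<rightarrow>\<^sub>E {..<(2::nat) ^ b}. \<forall>i\<in>B \<times> Cs.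
     real (card (nbr V E (fst i))) * real (card (snd i)) / real ((2::nat) ^ b) / 4
        \<le> real (card {x\<in>nbr V E (fst i). c x \<in> snd i}) \<and>
     real (card {x\<in>nbr V E (fst i). c x \<in> snd i})
        \<le> 3 * (real (card (nbr V E (fst i))) * real (card (snd i)) / real ((2::nat) ^ b))"
  proof (rule balanced_colouring[where D = "d\<^sup>2"])
    show "nbr V E (fst i) \<subseteq> A \<and> card (nbr V E (fst i)) \<le> d\<^sup>2" if "i \<in> B \<times> Cs" for i
      using nbrB[of "fst i"] degA(1)[of "fst i"] that AB d_sq by auto
    show "card {i\<in>B \<times> Cs. u \<in> nbr V E (fst i)} \<le> d\<^sup>2" if "u \<in> A" for u
    proof -
      have "{i\<in>B \<times> Cs. u \<in> nbr V E (fst i)} \<subseteq> nbr V E u \<times> Cs" using nbr_sym by auto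
      hence "card {i\<in>B \<times> Cs. u \<in> nbr V E (fst i)} \<le> card (nbr V E u \<times> Cs)"
        by (rule card_mono[rotated]) (use fin_nbr finCs in auto)
      also have "\<dots> = card (nbr V E u) * card Cs" by (rule card_cartesian_product)
      also have "\<dots> \<le> d * d" using degA(1)[of u] that AB(1) cardCs bd by (intro mult_mono) auto
      finally show ?thesis by (simp add: power2_eq_square)
    qed
    show "snd i \<subseteq> {..<2 ^ b}" if "i \<in> B \<times> Cs" for i using that Cs[of "snd i"] by (auto simp: mem_Times_iff)
    show "4 * ln (8 * real (d\<^sup>2) ^ 2) \<le> real (card (nbr V E (fst i))) * real (card (snd i)) / real ((2::nat) ^ b)"
      if "i \<in> B \<times> Cs" for i
    proof -
      have "fst i \<in> V" using that AB(1) by auto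
      hence "4 * (real k + 1) * 2 ^ b \<le> real (card (nbr V E (fst i)))" using degA(2) last by force
      also have "\<dots> \<le> real (card (nbr V E (fst i))) * real (card (snd i))"
        using that Cs[of "snd i"] mult_left_mono[of 1 "real (card (snd i))" "real (card (nbr V E (fst i)))"] by (auto simp: mem_Times_iff)
      finally have "4 * (real k + 1) \<le> real (card (nbr V E (fst i))) * real (card (snd i)) / 2 ^ b"
        by (simp add: field_simps)
      thus ?thesis using log_le by simp
    qed
  qed (use fin finCs d_sq0 in auto)
  then obtain g where g: "g \<in> A \<rightarrow>\<^sub>E {..<(2::nat) ^ b}" and gCs': "\<forall>w\<in>B. \<forall>C\<in>Cs.
     real (card (nbr V E w)) * real (card C) / 2 ^ b / 4 \<le> real (card {x\<in>nbr V E w. g x \<in> C}) \<and>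
     real (card {x\<in>nbr V E w. g x \<in> C}) \<le> 3 * (real (card (nbr V E w)) * real (card C) / 2 ^ b)"
    by simp blast
  note gCs = gCs'[rule_format]

  \<comment> \<open>Levels start at \<open>a\<close> because the expected number of saving edges at
    a vertex of level \<open>j\<close> is proportional to \<open>2 ^ j\<close>; from
    \<open>a\<close> on it reaches the threshold for concentration.\<close>
  define dy where "dy u j \<longleftrightarrow> u \<in> A \<and> a \<le> j \<and> j < b \<and> 2 ^ (b - j - 1) \<le> g u \<and> g u < 2 ^ (b - j)" for u j
  have dy_unique: "j = l" if "dy u j" "dy u l" for u j l
  proof -
    have "(2::nat) ^ (b - j - 1) < 2 ^ (b - l)" "(2::nat) ^ (b - l - 1) < 2 ^ (b - j)"
      using that unfolding dy_def by linarith+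
    hence "b - j - 1 < b - l" "b - l - 1 < b - j" by (auto dest: power_less_imp_less_exp[rotated])
    thus ?thesis using that by (auto simp: dy_def)
  qed
  have below: "real (card {x\<in>nbr V E w. g x < 2 ^ (b - j)}) \<le> 3 * real d / 2 ^ j" if "w \<in> B" "j \<le> b" for w j
  proof -
    have "{..<2 ^ (b - j)} \<in> Cs" using that by (auto simp: Cs_def)
    from gCs[OF that(1) this] have "real (card {x\<in>nbr V E w. g x < 2 ^ (b - j)})
        \<le> 3 * (real (card (nbr V E w)) * 2 ^ (b - j) / 2 ^ b)" by simp
    also have "\<dots> = 3 * (real (card (nbr V E w)) / 2 ^ j)" using that by (simp add: power_diff field_simps)
    also have "\<dots> \<le> 3 * (real d / 2 ^ j)"
      using degA(1)[of w] that AB(1) by (intro mult_left_mono divide_right_mono) auto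
    finally show ?thesis by simp
  qed
  \<comment> \<open>A block is half of its initial segment and the lower tail costs a factor 4,
    which gives the 8.\<close>
  have level: "\<alpha> * real d / (8 * 2 ^ j) \<le> real (card {x\<in>nbr V E w. dy x j})" if w: "w \<in> B" and j: "a \<le> j" "j < b" for w j
  proof -
    have C: "{2 ^ (b - j - 1)..<2 ^ (b - j)} \<in> Cs" using j by (auto simp: Cs_def)
    have eq: "{x\<in>nbr V E w. dy x j} = {x\<in>nbr V E w. g x \<in> {2 ^ (b - j - 1)..<2 ^ (b - j)}}"
      using nbrB[OF w] j by (auto simp: dy_def)
    obtain m where m: "b = j + m + 1" using j(2) less_imp_add_positive[of j b] by (metis Suc_eq_plus1 add_Suc_right less_iff_Suc_add)
    have "real (card (nbr V E w)) * real (card {2 ^ (b - j - 1)..<2 ^ (b - j)::nat}) / 2 ^ b / 4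
        = real (card (nbr V E w)) / (8 * 2 ^ j)"
      unfolding m by (simp add: power_add field_simps)
    moreover have "\<alpha> * real d / (8 * 2 ^ j) \<le> real (card (nbr V E w)) / (8 * 2 ^ j)"
      using degA(2)[of w] w AB(1) by (intro divide_right_mono) auto
    ultimately show ?thesis using gCs[OF w C] unfolding eq by linarith
  qed

  \<comment> \<open>Random saving edges between \<open>A\<close> and the late vertices\<close>
  define X where "X = {(x, y). x \<in> A \<and> y \<in> S \<and> E x y}"
  have finX: "finite X" by (rule finite_subset[of _ "A \<times> S"]) (use fin finS in \<open>auto simp: X_def\<close>)
  define I where "I = {(v, j). j < b \<and> (dy v j \<or> v \<in> S \<and> a \<le> j)}"
  have finI: "finite I"
    by (rule finite_subset[of _ "V \<times> {..<b}"]) (use finV AB SB in \<open>auto simp: I_def dy_def\<close>)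
  \<comment> \<open>One family covers both ends: for \<open>u\<close> of level \<open>j\<close> in
    \<open>A\<close> these are its edges to \<open>S\<close>, and for \<open>w\<close> in
    \<open>S\<close> its edges from level \<open>j\<close>. The index carries the level because the
    saving colours \<open>{..<2 ^ j}\<close> depend on it.\<close>
  define F where "F i = {(x, y) \<in> X. dy x (snd i) \<and> (x = fst i \<or> y = fst i)}" for i
  have F_u: "F (u, j) = Pair u ` (nbr V E u \<inter> S)" if "dy u j" for u j
    using that AB(2) SB by (auto simp: F_def X_def dy_def nbr_iff)
  have F_w: "F (w, j) = (\<lambda>x. (x, w)) ` {x\<in>nbr V E w. dy x j}" if "w \<in> S" for w j
  proof -
    have "w \<notin> A" using that SB AB(2) by auto
    moreover have "E x w \<longleftrightarrow> x \<in> nbr V E w" for x using nbr_iff nbr_sym by blast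
    ultimately show ?thesis using that by (auto simp: F_def X_def dy_def)
  qed
  have cF_u: "card (F (u, j)) = card (nbr V E u \<inter> S)" if "dy u j" for u j
    unfolding F_u[OF that] by (intro card_image) (auto simp: inj_on_def)
  have cF_w: "card (F (w, j)) = card {x\<in>nbr V E w. dy x j}" if "w \<in> S" for w j
    unfolding F_w[OF that] by (intro card_image) (auto simp: inj_on_def)
  have mu_w: "\<alpha> * real d / (8 * 2 ^ t) \<le> real (card (F (w, j))) * 2 ^ j / 2 ^ t"
    if "w \<in> S" "a \<le> j" "j < b" for w j
  proof -
    have "\<alpha> * real d / (8 * 2 ^ t) = \<alpha> * real d / (8 * 2 ^ j) * 2 ^ j / 2 ^ t" by simp
    also have "\<dots> \<le> real (card (F (w, j))) * 2 ^ j / 2 ^ t"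
      using level[of w j] that SB cF_w[OF that(1)] by (intro divide_right_mono mult_right_mono) auto
    finally show ?thesis .
  qed
  have "\<exists>c\<in>X \<rightarrow>\<^sub>E {..<(2::nat) ^ t}. \<forall>i\<in>I.
     real (card (F i)) * real (card {..<2 ^ snd i :: nat}) / real ((2::nat) ^ t) / 4
        \<le> real (card {e\<in>F i. c e \<in> {..<2 ^ snd i}}) \<and>
     real (card {e\<in>F i. c e \<in> {..<2 ^ snd i}})
        \<le> 3 * (real (card (F i)) * real (card {..<2 ^ snd i :: nat}) / real ((2::nat) ^ t))"
  proof (rule balanced_colouring[where D = "d\<^sup>2"])
    fix i assume i: "i \<in> I"
    obtain v j where vj: "i = (v, j)" by (cases i)
    have v: "v \<in> V" using i AB(1) SB by (auto simp: vj I_def dy_def)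
    have jb: "j < b" using i by (auto simp: vj I_def)
    have "card (F i) \<le> card (nbr V E v)"
    proof (cases "dy v j")
      case True
      thus ?thesis unfolding vj cF_u[OF True] by (intro card_mono fin_nbr) auto
    next
      case False
      hence "v \<in> S" using i by (auto simp: vj I_def)
      thus ?thesis unfolding vj using cF_w[of v j] by (simp add: card_mono fin_nbr)
    qed
    thus "F i \<subseteq> X \<and> card (F i) \<le> d\<^sup>2" using degA(1)[OF v] d_sq by (auto simp: F_def)
    have "(2::nat) ^ j \<le> 2 ^ t" using jb bt by (intro power_increasing) auto
    thus "{..<2 ^ snd i} \<subseteq> {..<(2::nat) ^ t}" by (auto simp: vj)
    show "4 * ln (8 * real (d\<^sup>2) ^ 2) \<le> real (card (F i)) * real (card {..<2 ^ snd i :: nat}) / real ((2::nat) ^ t)"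
    proof (cases "dy v j")
      case True
      have v: "v \<in> A" "a \<le> j" using True by (auto simp: dy_def)
      have "\<alpha> * real d / 2 ^ q / 4 \<le> real (card (nbr V E v)) / 2 ^ q / 4"
        using degA(2)[OF \<open>v \<in> V\<close>] by (intro divide_right_mono) auto
      hence "\<alpha> * real d / 2 ^ q / 4 \<le> real (card (F i))" using S(1)[OF v(1)] by (simp add: vj cF_u[OF True])
      moreover have "(2::real) ^ a \<le> 2 ^ j" using v by (intro power_increasing) auto
      ultimately have "\<alpha> * real d / 2 ^ q / 4 * 2 ^ a / 2 ^ t \<le> real (card (F i)) * 2 ^ j / 2 ^ t"
        by (intro divide_right_mono mult_mono) auto
      moreover have "\<alpha> * real d / 2 ^ q / 4 * 2 ^ a / 2 ^ t = \<alpha> * real d * 2 ^ a / (4 * 2 ^ q * 2 ^ t)"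
        by simp
      ultimately have "4 * ln (8 * real (d\<^sup>2) ^ 2) \<le> real (card (F i)) * 2 ^ j / 2 ^ t"
        using match_u by linarith
      thus ?thesis by (simp add: vj)
    next
      case False
      hence v: "v \<in> S" "a \<le> j" using i by (auto simp: vj I_def)
      show ?thesis using mu_w[OF v jb] match_w by (simp add: vj)
    qed
  next
    fix e assume "e \<in> X"
    obtain x y where e: "e = (x, y)" by (cases e)
    \<comment> \<open>The level of the end in \<open>A\<close> is unique, so an edge belongs to at
      most one index for each of its two ends.\<close>
    have "card {i\<in>I. e \<in> F i} \<le> 2"
    proof (cases "\<exists>j. dy x j")
      case True
      then obtain j where j: "dy x j" by blast
      have "{i\<in>I. e \<in> F i} \<subseteq> {(x, j), (y, j)}"
        using dy_unique[OF j] by (auto simp: e F_def)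
      hence "card {i\<in>I. e \<in> F i} \<le> card {(x, j), (y, j)}" by (rule card_mono[rotated]) simp
      also have "\<dots> \<le> 2" by (simp add: card_insert_if)
      finally show ?thesis .
    next
      case False
      hence no: "{i\<in>I. e \<in> F i} = {}" by (auto simp: e F_def)
      show ?thesis unfolding no by simp
    qed
    thus "card {i\<in>I. e \<in> F i} \<le> d\<^sup>2" using d2 d_sq by linarith
  qed (use finX finI d_sq0 in auto)
  then obtain c :: "'a \<times> 'a \<Rightarrow> nat" where c': "\<forall>i\<in>I.
     real (card (F i)) * 2 ^ snd i / 2 ^ t / 4 \<le> real (card {e\<in>F i. c e < 2 ^ snd i}) \<and>
     real (card {e\<in>F i. c e < 2 ^ snd i}) \<le> 3 * (real (card (F i)) * 2 ^ snd i / 2 ^ t)"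
    by simp blast
  note c = c'[rule_format]

  \<comment> \<open>Verification of the saving scheme\<close>
  define lev where "lev u = (SOME j. dy u j)" for u
  have lev: "lev u = j" if "dy u j" for u j
    using someI[of "dy u", OF that] dy_unique[OF that] by (simp add: lev_def)
  \<comment> \<open>If \<open>u\<close> has no level, \<open>lev u\<close> is an arbitrary number;
    the conjunct \<open>dy u (lev u)\<close> then makes \<open>M u\<close> empty.\<close>
  define M where "M u = {w\<in>nbr V E u \<inter> S. dy u (lev u) \<and> c (u, w) < 2 ^ lev u}" for u
  define A\<^sub>0 where "A\<^sub>0 = {u\<in>A. g u = 0}"
  have dy_pos: "u \<in> A - A\<^sub>0" if "dy u j" for u j
  proof -
    have "0 < (2::nat) ^ (b - j - 1)" by simp
    hence "0 < g u" using that unfolding dy_def by linarith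
    thus ?thesis using that by (simp add: dy_def A\<^sub>0_def)
  qed
  show ?thesis
  proof (rule removable_by_saving[OF G AB bip SB, where g = g and N = "2 ^ b" and M = M
        and A\<^sub>0 = A\<^sub>0 and r = "\<lambda>u. 3 * real d / 2 ^ lev u"])
    show "g u < 2 ^ b" if "u \<in> A" for u using g that by (auto dest: PiE_mem)
    show "A\<^sub>0 = {u\<in>A. g u = 0}" by (rule A\<^sub>0_def)
    show "M u \<subseteq> nbr V E u \<inter> S" for u by (auto simp: M_def)
    show "M u = {}" if "u \<notin> A - A\<^sub>0" for u using that dy_pos by (auto simp: M_def)
  next
    fix u assume u: "u \<in> A"
    hence "u \<in> V" using AB(1) by auto
    hence "4 * (real k + 1) * 2 ^ q \<le> real (card (nbr V E u))" using degA(2) late by force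
    hence "real k + 1 \<le> real (card (nbr V E u)) / 2 ^ q / 4" by (simp add: field_simps)
    thus "k + 1 \<le> card (nbr V E u \<inter> S)" using S(1)[OF u] by linarith
  next
    fix w assume w: "w \<in> B"
    hence "w \<in> V" using AB(1) by auto
    hence "4 * (real k + 1) * 2 ^ b \<le> real (card (nbr V E w))" using degA(2) last by force
    hence 1: "real k + 1 \<le> real (card (nbr V E w)) / 2 ^ b / 4" by (simp add: field_simps)
    have "{..<2 ^ (b - b)} \<in> Cs" unfolding Cs_def by blast
    hence C: "{..<1} \<in> Cs" by simp
    have "nbr V E w \<inter> A\<^sub>0 = {x\<in>nbr V E w. g x \<in> {..<1}}" using nbrB[OF w] by (auto simp: A\<^sub>0_def)
    hence "real (card (nbr V E w)) / 2 ^ b / 4 \<le> real (card (nbr V E w \<inter> A\<^sub>0))"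
      using gCs[OF w C] by simp
    thus "k + 1 \<le> card (nbr V E w \<inter> A\<^sub>0)" using 1 by linarith
  next
    fix u w assume w: "w \<in> M u"
    hence dy: "dy u (lev u)" and wB: "w \<in> B" using SB by (auto simp: M_def)
    have "card {x\<in>nbr V E w. g x \<le> g u} \<le> card {x\<in>nbr V E w. g x < 2 ^ (b - lev u)}"
      using dy fin_nbr by (intro card_mono) (auto simp: dy_def)
    thus "real (card {x\<in>nbr V E w. g x \<le> g u}) \<le> 3 * real d / 2 ^ lev u"
      using below[OF wB, of "lev u"] dy by (simp add: dy_def)
  next
    fix u assume u: "u \<in> A - A\<^sub>0"
    hence uA: "u \<in> A" and uV: "u \<in> V" using AB(1) by auto
    define D where "D = real (deg V E u)"
    have D: "4 * (real k + 1) \<le> D"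
    proof -
      have "4 * (real k + 1) * 1 \<le> 4 * (real k + 1) * 2 ^ q" by (intro mult_left_mono) auto
      thus ?thesis using late deg_ge[OF uV] unfolding D_def by linarith
    qed
    have "real (card (M u)) * (3 * real d / 2 ^ lev u) \<le> D / 2"
    proof (cases "dy u (lev u)")
      case True
      have I: "(u, lev u) \<in> I" using True by (auto simp: I_def dy_def)
      have "{e\<in>F (u, lev u). c e < 2 ^ lev u} = Pair u ` M u"
        using True by (auto simp: F_u M_def)
      hence "card {e\<in>F (u, lev u). c e < 2 ^ lev u} = card (M u)"
        by (simp add: card_image inj_on_def)
      hence "real (card (M u)) \<le> 3 * (real (card (nbr V E u \<inter> S)) * 2 ^ lev u / 2 ^ t)"
        using c[OF I] cF_u[OF True] by simp
      also have "\<dots> \<le> 3 * (3 * (D / 2 ^ q) * 2 ^ lev u / 2 ^ t)"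
        using S(2)[OF uA] by (intro mult_left_mono divide_right_mono mult_right_mono) (auto simp: D_def deg_def)
      finally have "real (card (M u)) * (3 * real d / 2 ^ lev u)
          \<le> 3 * (3 * (D / 2 ^ q) * 2 ^ lev u / 2 ^ t) * (3 * real d / 2 ^ lev u)"
        by (intro mult_right_mono) auto
      \<comment> \<open>The powers \<open>2 ^ lev u\<close> cancel, which is why saving edges have
        probability proportional to \<open>2 ^ j\<close>. The 27 collects three upper tails: late
        neighbours, saving edges and remaining neighbours.\<close>
      also have "\<dots> = 27 * (D * (real d / (2 ^ q * 2 ^ t)))" by (simp add: field_simps)
      also have "\<dots> \<le> 27 * (D * (1 / 64))"
        using rate D by (intro mult_left_mono) (auto simp: field_simps)
      also have "\<dots> \<le> D / 2" using D by simp
      finally show ?thesis .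
    next
      case False
      hence "M u = {}" by (simp add: M_def)
      thus ?thesis using D by simp
    qed
    also have "D / 2 < D - real k" using D by (simp add: field_simps)
    finally show "real (card (M u)) * (3 * real d / 2 ^ lev u) < real (deg V E u) - real k"
      by (simp add: D_def)
  next
    fix w assume w: "w \<in> S"
    define H where "H j = {u\<in>nbr V E w. dy u j \<and> c (u, w) < 2 ^ j}" for j
    \<comment> \<open>The bound is the same for every level: the level size decays like
      \<open>2 ^ j\<close> in the denominator, and the saving probability grows at the same rate.
      The 32 is the 8 from the level size times the 4 from the lower tail.\<close>
    have cH: "\<alpha> * real d / (32 * 2 ^ t) \<le> real (card (H j))" if j: "j \<in> {a..<b}" for j
    proof -
      have I: "(w, j) \<in> I" using w j by (auto simp: I_def)
      have "{e\<in>F (w, j). c e < 2 ^ j} = (\<lambda>x. (x, w)) ` H j"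
        unfolding F_w[OF w] H_def by auto
      hence eq: "card {e\<in>F (w, j). c e < 2 ^ j} = card (H j)" by (simp add: card_image inj_on_def)
      have "\<alpha> * real d / (32 * 2 ^ t) = \<alpha> * real d / (8 * 2 ^ t) / 4" by simp
      also have "\<dots> \<le> real (card (F (w, j))) * 2 ^ j / 2 ^ t / 4"
        by (intro divide_right_mono mu_w) (use w j in auto)
      also have "\<dots> \<le> real (card (H j))" using c[OF I] unfolding snd_conv eq by simp
      finally show ?thesis .
    qed
    have sub: "(\<Union>j\<in>{a..<b}. H j) \<subseteq> {u\<in>A. w \<in> M u}"
      using lev w nbr_sym by (auto simp: H_def M_def dy_def)
    have "real k + 1 \<le> real (b - a) * (\<alpha> * real d) / (32 * 2 ^ t)" by (rule total)
    also have "\<dots> = (\<Sum>j\<in>{a..<b}. \<alpha> * real d / (32 * 2 ^ t))" by simp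
    also have "\<dots> \<le> (\<Sum>j\<in>{a..<b}. real (card (H j)))" by (intro sum_mono cH)
    also have "\<dots> = real (\<Sum>j\<in>{a..<b}. card (H j))" by simp
    also have "(\<Sum>j\<in>{a..<b}. card (H j)) = card (\<Union>j\<in>{a..<b}. H j)"
      by (rule card_UN_disjoint[symmetric]) (use fin_nbr dy_unique in \<open>auto simp: H_def\<close>)
    also have "real (card (\<Union>j\<in>{a..<b}. H j)) \<le> real (card {u\<in>A. w \<in> M u})"
      using card_mono[OF _ sub] fin by simp
    finally show "k + 1 \<le> card {u\<in>A. w \<in> M u}" by linarith
  qed
qed

section \<open>Choice of parameters\<close>

text \<open>Here \<open>\<kappa>\<close> has order \<open>sqrt (d * ln d)\<close>. The exponents
  1/10 and 3/10 lie below 1/2, which leaves polynomial room in the second and third bounds, and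
  their gap supplies a number of levels proportional to \<open>ln d\<close>. The bounds come in the
  order in which the parameter choice consumes them.\<close>

lemma eventually_parameter_bounds:
  fixes \<alpha> :: real
  assumes "\<alpha> > 0"
  defines "\<kappa> \<equiv> \<lambda>d. \<alpha> / 1000 * sqrt (real d * ln (real d))"
  shows "eventually (\<lambda>d. 1 \<le> \<kappa> d) sequentially"
    and "eventually (\<lambda>d. 8 * \<kappa> d * real d powr (3/10) \<le> \<alpha> * real d) sequentially"
    and "eventually (\<lambda>d. real d powr (3/10) \<le> \<kappa> d) sequentially"
    and "eventually (\<lambda>d. ln (8 * real d ^ 4) \<le> \<kappa> d) sequentially"
    and "eventually (\<lambda>d. 4 * ln (8 * real d ^ 4) \<le> \<alpha> * real d powr (1/10) / 1024) sequentially"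
    and "eventually (\<lambda>d. 4 * ln (8 * real d ^ 4) \<le> \<alpha>\<^sup>2 * real d / (16384 * \<kappa> d)) sequentially"
    and "eventually (\<lambda>d. 14/100 * ln (real d) \<le> 2/10 * ln (real d) - 1) sequentially"
    and "eventually (\<lambda>d. 6/10 * log 2 (real d) + 1 \<le> real d) sequentially"
    and "eventually (\<lambda>d. 2 \<le> d) sequentially"
  unfolding \<kappa>_def using assms(1) by real_asymp+

lemma power2_nat_floor_log:
  fixes x :: real
  assumes "1 \<le> x"
  shows "2 ^ nat \<lfloor>log 2 x\<rfloor> \<le> x" and "x < 2 * 2 ^ nat \<lfloor>log 2 x\<rfloor>"
proof -
  let ?n = "nat \<lfloor>log 2 x\<rfloor>"
  have "0 \<le> log 2 x" using assms by simp
  hence n: "real ?n \<le> log 2 x" "log 2 x < real ?n + 1" by linarith+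
  have "2 ^ ?n = 2 powr real ?n" by (simp add: powr_realpow)
  also have "\<dots> \<le> 2 powr log 2 x" using n by (intro powr_mono) auto
  finally show "2 ^ ?n \<le> x" using assms by simp
  have "x = 2 powr log 2 x" using assms by simp
  also have "\<dots> < 2 powr (real ?n + 1)" using n by (intro powr_less_mono) auto
  also have "\<dots> = 2 * 2 ^ ?n" by (simp add: powr_add powr_realpow)
  finally show "x < 2 * 2 ^ ?n" .
qed

text \<open>Write \<open>K\<close> for \<open>k + 1\<close>. Up to constants, \<open>2 ^ a\<close>
  and \<open>2 ^ b\<close> are \<open>d powr (1/10)\<close> and \<open>d powr (3/10)\<close>,
  \<open>2 ^ q\<close> is \<open>\<alpha> * d / K\<close>, so that each vertex of \<open>A\<close>
  gets about \<open>K\<close> or more late neighbours, and \<open>2 ^ t\<close> is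
  \<open>d / 2 ^ q\<close>, the largest saving rate that can be afforded. The number of saves is
  then of order \<open>\<alpha>^2 * d * ln d / K\<close>, which exceeds \<open>K\<close> for a small
  enough constant in \<open>\<kappa>\<close>.\<close>

lemma dyadic_parameters:
  fixes \<alpha> \<kappa> :: real and d :: nat
  assumes \<alpha>: "0 < \<alpha>" "\<alpha> \<le> 1"
    and \<kappa>: "\<kappa> = \<alpha> / 1000 * sqrt (real d * ln (real d))"
    and \<kappa>1: "1 \<le> \<kappa>"
    and \<kappa>_upper: "8 * \<kappa> * real d powr (3/10) \<le> \<alpha> * real d"
    and \<kappa>_lower: "real d powr (3/10) \<le> \<kappa>" "ln (8 * real d ^ 4) \<le> \<kappa>"
    and log_u: "4 * ln (8 * real d ^ 4) \<le> \<alpha> * real d powr (1/10) / 1024"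
    and log_w: "4 * ln (8 * real d ^ 4) \<le> \<alpha>\<^sup>2 * real d / (16384 * \<kappa>)"
    and log_d: "14/100 * ln (real d) \<le> 2/10 * ln (real d) - 1" "6/10 * log 2 (real d) + 1 \<le> real d"
    and d2: "2 \<le> d"
  defines "k \<equiv> nat \<lfloor>\<kappa>\<rfloor>"
  obtains a b q t :: nat where "b \<le> t" "2 * b + 1 \<le> d"
    "4 * ln (8 * real (d\<^sup>2) ^ 2) \<le> 4 * (real k + 1)"
    "4 * (real k + 1) * 2 ^ q \<le> \<alpha> * real d"
    "4 * (real k + 1) * 2 ^ b \<le> \<alpha> * real d"
    "4 * ln (8 * real (d\<^sup>2) ^ 2) \<le> \<alpha> * real d * 2 ^ a / (4 * 2 ^ q * 2 ^ t)"
    "4 * ln (8 * real (d\<^sup>2) ^ 2) \<le> \<alpha> * real d / (8 * 2 ^ t)"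
    "64 * real d \<le> 2 ^ q * 2 ^ t"
    "real k + 1 \<le> real (b - a) * (\<alpha> * real d) / (32 * 2 ^ t)"
proof -
  define K where "K = real k + 1"
  have K: "\<kappa> \<le> K" "K \<le> 2 * \<kappa>" "1 \<le> K" using \<kappa>1 unfolding K_def k_def by linarith+
  have d0: "0 < real d" "1 < real d" using d2 by auto
  have \<alpha>d: "0 < \<alpha> * real d" using \<alpha> d0 by simp
  have ln_eq: "8 * real (d\<^sup>2) ^ 2 = 8 * real d ^ 4" by simp
  define a where "a = nat \<lfloor>log 2 (real d powr (1/10))\<rfloor>"
  define b where "b = nat \<lfloor>log 2 (real d powr (3/10))\<rfloor>"
  have powr1: "1 \<le> real d powr (1/10)" "1 \<le> real d powr (3/10)"
    using d0 by (auto intro: ge_one_powr_ge_zero)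
  have a: "real d powr (1/10) < 2 * 2 ^ a" unfolding a_def by (rule power2_nat_floor_log[OF powr1(1)])
  have b: "2 ^ b \<le> real d powr (3/10)" unfolding b_def by (rule power2_nat_floor_log[OF powr1(2)])
  have log_powr': "log 2 (real d powr (1/10)) = 1/10 * log 2 (real d)"
    "log 2 (real d powr (3/10)) = 3/10 * log 2 (real d)" using d0 by (auto simp: log_powr)
  have log0: "0 \<le> log 2 (real d)" using d0 by simp
  have a_le: "real a \<le> 1/10 * log 2 (real d)" unfolding a_def log_powr' using log0 by linarith
  have b_bounds: "real b \<le> 3/10 * log 2 (real d)" "3/10 * log 2 (real d) - 1 \<le> real b"
    unfolding b_def log_powr' using log0 by linarith+
  have last: "4 * K * 2 ^ b \<le> \<alpha> * real d"
  proof -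
    have "4 * K * 2 ^ b \<le> 4 * (2 * \<kappa>) * real d powr (3/10)"
      using K b \<kappa>1 by (intro mult_mono) auto
    thus ?thesis using \<kappa>_upper by simp
  qed
  have K_le: "4 * K \<le> \<alpha> * real d"
  proof -
    have "4 * K * 1 \<le> 4 * K * 2 ^ b" using K by (intro mult_left_mono) auto
    thus ?thesis using last by simp
  qed
  define q where "q = nat \<lfloor>log 2 (\<alpha> * real d / (4 * K))\<rfloor>"
  define Q :: real where "Q = 2 ^ q"
  have "1 \<le> \<alpha> * real d / (4 * K)" using K_le K by simp
  from power2_nat_floor_log[OF this]
  have Q: "4 * K * Q \<le> \<alpha> * real d" "\<alpha> * real d < 8 * K * Q"
    using K unfolding Q_def q_def by (simp_all add: field_simps)
  have Q1: "1 \<le> Q" by (simp add: Q_def)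
  have Q_le: "Q \<le> real d"
  proof -
    have "1 * Q \<le> 4 * K * Q" using K Q1 by (intro mult_right_mono) auto
    also have "\<dots> \<le> 1 * real d" using Q(1) \<alpha>(2) mult_right_mono[of \<alpha> 1 "real d"] by linarith
    finally show ?thesis by simp
  qed
  define s where "s = nat \<lfloor>log 2 (64 * real d / Q)\<rfloor>"
  \<comment> \<open>\<open>Suc s\<close> rounds the logarithm up, since \<open>Q * T\<close> has to
    be at least \<open>64 * d\<close>; the rounding loses at most a factor 2.\<close>
  define T :: real where "T = 2 ^ Suc s"
  have "1 \<le> 64 * real d / Q" using Q_le Q1 by simp
  from power2_nat_floor_log[OF this]
  have T: "64 * real d \<le> Q * T" "Q * T \<le> 128 * real d"
    using Q1 unfolding T_def s_def by (simp_all add: field_simps)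
  have T0: "0 < T" by (simp add: T_def)
  \<comment> \<open>The 1024 is 8 from the rounding in \<open>Q\<close> times 128 from the rounding
    in \<open>T\<close>.\<close>
  have \<alpha>T: "\<alpha> * T \<le> 1024 * K"
  proof -
    have "\<alpha> * real d * T \<le> 8 * K * Q * T" using Q(2) T0 by (intro mult_right_mono) auto
    also have "\<dots> = 8 * K * (Q * T)" by simp
    also have "\<dots> \<le> 8 * K * (128 * real d)" using T(2) K by (intro mult_left_mono) auto
    finally have "real d * (\<alpha> * T) \<le> real d * (1024 * K)" by (simp add: mult_ac)
    thus ?thesis using d0 by simp
  qed
  have rate_w: "\<alpha>\<^sup>2 * real d / (1024 * K) \<le> \<alpha> * real d / T"
  proof -
    have "\<alpha> * real d * (\<alpha> * T) \<le> \<alpha> * real d * (1024 * K)" using \<alpha>T \<alpha>d by (intro mult_left_mono) auto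
    thus ?thesis using K T0 by (simp add: field_simps power2_eq_square)
  qed
  show ?thesis
  proof (rule that[of b "Suc s" q a])
    \<comment> \<open>To obtain \<open>b \<le> Suc s\<close>, the chain
      \<open>2 ^ b \<le> d powr (3/10) \<le> \<kappa> \<le> K \<le> T\<close> is used; its last link
      comes from comparing \<open>K * Q\<close> and \<open>Q * T\<close> with
      \<open>d\<close>.\<close>
    have "K * Q \<le> \<alpha> * real d" using Q(1) K Q1 mult_nonneg_nonneg[of K Q] by linarith
    also have "\<dots> \<le> 1 * real d" using \<alpha> by (intro mult_right_mono) auto
    also have "\<dots> \<le> Q * T" using T(1) d0 by linarith
    finally have "K \<le> T" using Q1 by (simp add: mult.commute)
    hence "(2::real) ^ b \<le> 2 ^ Suc s" using b \<kappa>_lower(1) K(1) unfolding T_def by linarith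
    thus "b \<le> Suc s" by (rule power_le_imp_le_exp[rotated]) simp
    show "2 * b + 1 \<le> d" using b_bounds(1) log_d(2) by linarith
    show "4 * ln (8 * real (d\<^sup>2) ^ 2) \<le> 4 * (real k + 1)"
      unfolding ln_eq using order_trans[OF \<kappa>_lower(2) K(1)] by (simp add: K_def)
    show "4 * (real k + 1) * 2 ^ q \<le> \<alpha> * real d" using Q(1) by (simp add: Q_def K_def)
    show "4 * (real k + 1) * 2 ^ b \<le> \<alpha> * real d" using last by (simp add: K_def)
    show "64 * real d \<le> 2 ^ q * 2 ^ Suc s" using T(1) by (simp add: Q_def T_def)
    have "\<alpha> * real d powr (1/10) / 1024 \<le> \<alpha> * (2 * 2 ^ a) / 1024"
      using a \<alpha> by (intro divide_right_mono mult_left_mono) auto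
    also have "\<dots> = \<alpha> * real d * 2 ^ a / (4 * (128 * real d))" using d0 by simp
    also have "\<dots> \<le> \<alpha> * real d * 2 ^ a / (4 * (Q * T))"
      using T(2) Q1 T0 \<alpha>d d0 by (intro divide_left_mono mult_left_mono) (auto intro!: mult_pos_pos)
    finally show "4 * ln (8 * real (d\<^sup>2) ^ 2) \<le> \<alpha> * real d * 2 ^ a / (4 * 2 ^ q * 2 ^ Suc s)"
      unfolding ln_eq using log_u unfolding Q_def T_def mult.assoc by linarith
    have "\<alpha>\<^sup>2 * real d / (16384 * \<kappa>) = \<alpha>\<^sup>2 * real d / (1024 * (2 * \<kappa>)) / 8" by simp
    also have "\<dots> \<le> \<alpha>\<^sup>2 * real d / (1024 * K) / 8"
      using K d0 \<kappa>1 by (intro divide_right_mono divide_left_mono mult_left_mono) (auto intro!: mult_pos_pos)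
    also have "\<dots> \<le> \<alpha> * real d / T / 8" using rate_w by (intro divide_right_mono) auto
    also have "\<dots> = \<alpha> * real d / (8 * T)" by simp
    finally show "4 * ln (8 * real (d\<^sup>2) ^ 2) \<le> \<alpha> * real d / (8 * 2 ^ Suc s)"
      unfolding ln_eq using log_w unfolding T_def by linarith
    have ln_log: "ln (real d) \<le> log 2 (real d)"
    proof -
      have "log 2 (real d) * ln 2 = ln (real d)" by (simp add: log_def)
      thus ?thesis using mult_left_mono[OF ln2_bounds(2) log0] by simp
    qed
    \<comment> \<open>The gap of the exponents is 2/10, rounding \<open>b\<close> down costs at most
      1, and \<open>log 2 d\<close> is at least \<open>ln d\<close>; the 14/100 leaves room for the
      rounding.\<close>
    have ba: "14/100 * ln (real d) \<le> real (b - a)"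
      using a_le b_bounds(2) log_d(1) ln_log by linarith
    \<comment> \<open>Here the constant 1/1000 enters: since \<open>K \<le> 2 * \<kappa>\<close>,
      the quantity \<open>32 * 1024 * K^2\<close> is at most 0.132 times
      \<open>\<alpha>^2 * d * ln d\<close>, just within the 14/100 supplied by the number of
      levels.\<close>
    have "K\<^sup>2 \<le> (2 * \<kappa>)\<^sup>2" using K by (intro power_mono) auto
    also have "(2 * \<kappa>)\<^sup>2 = 4 / 1000000 * (\<alpha>\<^sup>2 * (real d * ln (real d)))"
      using d0 unfolding \<kappa> by (simp add: power_mult_distrib power_divide)
    finally have "K\<^sup>2 \<le> 4 / 1000000 * (\<alpha>\<^sup>2 * (real d * ln (real d)))" .
    moreover have "0 \<le> \<alpha>\<^sup>2 * (real d * ln (real d))" using d0 by simp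
    ultimately have "32768 * K\<^sup>2 \<le> (14/100) * (\<alpha>\<^sup>2 * (real d * ln (real d)))" by linarith
    also have "\<dots> = 14/100 * ln (real d) * (\<alpha>\<^sup>2 * real d)" by simp
    also have "\<dots> \<le> real (b - a) * (\<alpha>\<^sup>2 * real d)" using ba d0 by (intro mult_right_mono) auto
    finally have "K \<le> real (b - a) * (\<alpha>\<^sup>2 * real d / (1024 * K)) / 32"
      using K by (simp add: field_simps power2_eq_square)
    also have "\<dots> \<le> real (b - a) * (\<alpha> * real d / T) / 32"
      using rate_w by (intro divide_right_mono mult_left_mono) auto
    also have "\<dots> = real (b - a) * (\<alpha> * real d) / (32 * T)" by (simp add: mult.commute)
    finally show "real k + 1 \<le> real (b - a) * (\<alpha> * real d) / (32 * 2 ^ Suc s)"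
      unfolding K_def T_def .
  qed
qed

theorem theorem4p3:
  fixes \<alpha> :: real
  assumes "0 < \<alpha>" and "\<alpha> \<le> 1"
  shows "\<exists>d0::nat. d0 \<ge> 1 \<and> (\<forall>d::nat. d \<ge> d0 \<longrightarrow>
     (\<forall>(V::'a set) E. simple_graph V E \<and> bipartite V E \<and> max_degree V E d
        \<and> (\<forall>v\<in>V. real (deg V E v) \<ge> \<alpha> * real d)
        \<longrightarrow> removable V E (\<lambda>v. int (deg V E v) - \<lfloor>\<alpha> / 1000 * sqrt (real d * ln (real d))\<rfloor>)))"
proof -
  have "eventually (\<lambda>d. \<forall>(V::'a set) E. simple_graph V E \<and> bipartite V E \<and> max_degree V E d
        \<and> (\<forall>v\<in>V. real (deg V E v) \<ge> \<alpha> * real d)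
        \<longrightarrow> removable V E (\<lambda>v. int (deg V E v) - \<lfloor>\<alpha> / 1000 * sqrt (real d * ln (real d))\<rfloor>)) sequentially"
    using eventually_parameter_bounds[OF assms(1)]
  proof eventually_elim
    case (elim d)
    define k where "k = nat \<lfloor>\<alpha> / 1000 * sqrt (real d * ln (real d))\<rfloor>"
    \<comment> \<open>The floor is nonnegative because its argument is at least 1, so passing to a
      natural number loses nothing.\<close>
    have k: "int k = \<lfloor>\<alpha> / 1000 * sqrt (real d * ln (real d))\<rfloor>" using elim(1) by (simp add: k_def)
    show ?case
    proof (intro allI impI, elim conjE)
      fix V :: "'a set" and E
      assume G: "simple_graph V E" "bipartite V E" and max: "max_degree V E d"
        and min: "\<forall>v\<in>V. real (deg V E v) \<ge> \<alpha> * real d"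
      have "finite V" using G(1) by (simp add: simple_graph_def)
      hence deg_le: "deg V E v \<le> d" if "v \<in> V" for v
        using max that unfolding max_degree_def by (metis Max_ge finite_imageI imageI)
      obtain a b q t where params: "b \<le> t" "2 * b + 1 \<le> d"
        "4 * ln (8 * real (d\<^sup>2) ^ 2) \<le> 4 * (real k + 1)"
        "4 * (real k + 1) * 2 ^ q \<le> \<alpha> * real d"
        "4 * (real k + 1) * 2 ^ b \<le> \<alpha> * real d"
        "4 * ln (8 * real (d\<^sup>2) ^ 2) \<le> \<alpha> * real d * 2 ^ a / (4 * 2 ^ q * 2 ^ t)"
        "4 * ln (8 * real (d\<^sup>2) ^ 2) \<le> \<alpha> * real d / (8 * 2 ^ t)"
        "64 * real d \<le> 2 ^ q * 2 ^ t"
        "real k + 1 \<le> real (b - a) * (\<alpha> * real d) / (32 * 2 ^ t)"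
        unfolding k_def by (rule dyadic_parameters[OF assms refl elim])
      have "removable V E (\<lambda>v. int (deg V E v) - int k)"
        by (rule removable_if_dyadic_parameters[OF G deg_le min[rule_format] assms(1)
              params(1,2) elim(9) params(3-)])
      thus "removable V E (\<lambda>v. int (deg V E v) - \<lfloor>\<alpha> / 1000 * sqrt (real d * ln (real d))\<rfloor>)"
        unfolding k .
    qed
  qed
  then obtain d0 where d0: "\<forall>d\<ge>d0. \<forall>(V::'a set) E. simple_graph V E \<and> bipartite V E \<and> max_degree V E d
        \<and> (\<forall>v\<in>V. real (deg V E v) \<ge> \<alpha> * real d)
        \<longrightarrow> removable V E (\<lambda>v. int (deg V E v) - \<lfloor>\<alpha> / 1000 * sqrt (real d * ln (real d))\<rfloor>)"
    unfolding eventually_sequentially by blast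
  show ?thesis by (rule exI[of _ "max d0 1"]) (use d0 in auto)
qed

end
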